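(* Let $X=\mathbb{P}^1\times\mathbb{P}^1$ over $\mathbb{C}$, let $Z=\{P_1,\dots,P_s\}\subseteq X$ be a finite set of points and let $I$ be the radical ideal of $Z$. Assume that $$\alpha^{*}(I^{(m)})=\alpha^{*}(I^{(m+1)})$$ for some integer $m\geq 1$. Then there are finite sets $Z_V,Z_H\subset\mathbb{P}^1$ such that $Z=Z_V\times Z_H$, i.e. $Z$ is a grid in $X$.
   Context: $\mathbb{C}[X]=\mathbb{C}[x_0,x_1;y_0,y_1]$ is the bigraded coordinate ring of $X=\mathbb{P}^1\times\mathbb{P}^1$, and $\mathcal{O}_X(a,b)$ is the line bundle of bi-degree $(a,b)$. For a point $P=([a:b],[c:d])$, $I(P)$ is the prime ideal generated by $bx_0-ax_1$ and $dy_0-cy_1$. For $Z=\{P_1,\dots,P_s\}$ the radical ideal is $I=\bigcap_{i=1}^s I(P_i)$, and its $m$-th symbolic power is $I^{(m)}=\bigcap_{i=1}^s I(P_i)^m$; thus a bi-homogeneous form lies in $I^{(m)}$ exactly when it vanishes to order at least $m$ at each $P_i$. For a non-zero bi-homogeneous ideal $J\subset\mathbb{C}[X]$, $\alpha^{*}(J)$ is the least integer $k\ge 0$ such that $J$ contains a non-zero form of bi-degree $(k,k)$, i.e. $H^0(\mathcal{O}_X(k,k)\otimes J)\neq 0$. *)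

theory Defs
  imports Complex_Main "HOL-Library.Poly_Mapping"
begin

definition proportional :: "complex \<times> complex \<Rightarrow> complex \<times> complex \<Rightarrow> bool" where
  "proportional p q \<longleftrightarrow> p \<noteq> (0, 0) \<and> q \<noteq> (0, 0) \<and>
     (\<exists>t. t \<noteq> 0 \<and> fst q = t * fst p \<and> snd q = t * snd p)"

text \<open>The projective line over \<open>\<complex>\<close>; the relation is partial because \<open>(0, 0)\<close>
  represents no point.\<close>

quotient_type p1 = "complex \<times> complex" / partial: proportional
proof (rule part_equivpI)
  have "proportional (1, 0) (1, 0)"
    unfolding proportional_def by (intro conjI exI[of _ 1]) simp_all
  then show "\<exists>p. proportional p p" ..
  show "symp proportional"
  proof (rule sympI)
    fix p q assume "proportional p q"
    then obtain t where t: "t \<noteq> 0" "fst q = t * fst p" "snd q = t * snd p"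
      and nz: "p \<noteq> (0, 0)" "q \<noteq> (0, 0)"
      unfolding proportional_def by blast
    have "fst p = inverse t * fst q" "snd p = inverse t * snd q" "inverse t \<noteq> 0"
      using t by simp_all
    then show "proportional q p"
      unfolding proportional_def using nz by blast
  qed
  show "transp proportional"
  proof (rule transpI)
    fix p q r assume "proportional p q" "proportional q r"
    then obtain t u where t: "t \<noteq> 0" "fst q = t * fst p" "snd q = t * snd p"
      and u: "u \<noteq> 0" "fst r = u * fst q" "snd r = u * snd q"
      and nz: "p \<noteq> (0, 0)" "r \<noteq> (0, 0)"
      unfolding proportional_def by blast
    have "fst r = (u * t) * fst p" "snd r = (u * t) * snd p" "u * t \<noteq> 0"
      using t u by simp_all
    then show "proportional p r"
      unfolding proportional_def using nz by blast
  qed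
qed

text \<open>The coordinate ring \<open>\<complex>[x\<^sub>0, x\<^sub>1; y\<^sub>0, y\<^sub>1]\<close>: the outer \<open>poly_mapping\<close> sends monomials,
  given by their exponent vectors, to coefficients.\<close>

datatype var = X0 | X1 | Y0 | Y1

type_synonym monom = "var \<Rightarrow>\<^sub>0 nat"
type_synonym form_ring = "monom \<Rightarrow>\<^sub>0 complex"

definition Var :: "var \<Rightarrow> form_ring" where
  "Var v = Poly_Mapping.single (Poly_Mapping.single v 1) 1"

definition Const :: "complex \<Rightarrow> form_ring" where
  "Const c = Poly_Mapping.single 0 c"

definition bihomogeneous :: "nat \<Rightarrow> nat \<Rightarrow> form_ring \<Rightarrow> bool" where
  "bihomogeneous a b F \<longleftrightarrow>
     (\<forall>e \<in> Poly_Mapping.keys F.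
        Poly_Mapping.lookup e X0 + Poly_Mapping.lookup e X1 = a \<and> Poly_Mapping.lookup e Y0 + Poly_Mapping.lookup e Y1 = b)"

text \<open>Ideals of a commutative ring are the submodules of the ring over itself.\<close>

lemma module_times: "module ((*) :: 'a::comm_ring_1 \<Rightarrow> 'a \<Rightarrow> 'a)"
  by unfold_locales (simp_all add: algebra_simps)

definition ideal_gen :: "'a::comm_ring_1 set \<Rightarrow> 'a set" where
  "ideal_gen S = module.span (*) S"

definition ideal_mult :: "'a::comm_ring_1 set \<Rightarrow> 'a set \<Rightarrow> 'a set" where
  "ideal_mult I J = ideal_gen {f * g | f g. f \<in> I \<and> g \<in> J}"

fun ideal_power :: "'a::comm_ring_1 set \<Rightarrow> nat \<Rightarrow> 'a set" where
  "ideal_power I 0 = UNIV"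
| "ideal_power I (Suc m) = ideal_mult I (ideal_power I m)"

definition rep_ideal :: "complex \<times> complex \<Rightarrow> complex \<times> complex \<Rightarrow> form_ring set" where
  "rep_ideal p q = (case (p, q) of ((a, b), (c, d)) \<Rightarrow>
     ideal_gen {Const b * Var X0 - Const a * Var X1, Const d * Var Y0 - Const c * Var Y1})"

lemma Const_mult: "Const (s * t) = Const s * Const t"
  by (simp add: Const_def mult_single)

lemma rep_ideal_scale_subset:
  "rep_ideal (t * a, t * b) (u * c, u * d) \<subseteq> rep_ideal (a, b) (c, d)"
proof -
  interpret module "(*) :: form_ring \<Rightarrow> form_ring \<Rightarrow> form_ring" by (rule module_times)
  let ?f = "Const b * Var X0 - Const a * Var X1" and ?g = "Const d * Var Y0 - Const c * Var Y1"
  have "Const t * ?f \<in> span {?f, ?g}" "Const u * ?g \<in> span {?f, ?g}"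
    by (rule span_scale, rule span_base, simp)+
  moreover have "Const (t * b) * Var X0 - Const (t * a) * Var X1 = Const t * ?f"
    "Const (u * d) * Var Y0 - Const (u * c) * Var Y1 = Const u * ?g"
    by (simp_all only: Const_mult right_diff_distrib mult.assoc)
  ultimately have "{Const (t * b) * Var X0 - Const (t * a) * Var X1,
      Const (u * d) * Var Y0 - Const (u * c) * Var Y1} \<subseteq> span {?f, ?g}"
    by (simp only: insert_subset empty_subsetI simp_thms)
  then have "span {Const (t * b) * Var X0 - Const (t * a) * Var X1,
      Const (u * d) * Var Y0 - Const (u * c) * Var Y1} \<subseteq> span {?f, ?g}"
    by (rule span_minimal[OF _ subspace_span])
  then show ?thesis
    unfolding rep_ideal_def ideal_gen_def prod.case .
qed

lift_definition point_ideal :: "p1 \<Rightarrow> p1 \<Rightarrow> form_ring set" is rep_ideal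
proof -
  fix p p' q q' assume "proportional p p'" "proportional q q'"
  then obtain t u where tu: "t \<noteq> 0" "fst p' = t * fst p" "snd p' = t * snd p"
      "u \<noteq> 0" "fst q' = u * fst q" "snd q' = u * snd q"
    unfolding proportional_def by blast
  obtain a b c d where pq: "p = (a, b)" "q = (c, d)" by (cases p, cases q)
  then have p'q': "p' = (t * a, t * b)" "q' = (u * c, u * d)"
    using tu by (simp_all add: prod_eq_iff)
  have "rep_ideal (inverse t * (t * a), inverse t * (t * b))
      (inverse u * (u * c), inverse u * (u * d)) \<subseteq> rep_ideal p' q'"
    unfolding p'q' by (rule rep_ideal_scale_subset)
  moreover have "inverse t * (t * x) = x" "inverse u * (u * x) = x" for x
    using tu by simp_all
  ultimately have "rep_ideal p q \<subseteq> rep_ideal p' q'" by (simp only: pq)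
  moreover have "rep_ideal p' q' \<subseteq> rep_ideal p q"
    unfolding pq p'q' by (rule rep_ideal_scale_subset)
  ultimately show "rep_ideal p q = rep_ideal p' q'" ..
qed

definition radical_ideal :: "(p1 \<times> p1) set \<Rightarrow> form_ring set" where
  "radical_ideal Z = (\<Inter>(p, q) \<in> Z. point_ideal p q)"

text \<open>The symbolic powers \<open>I\<^sup>(\<^sup>m\<^sup>)\<close> of \<open>I = radical_ideal Z\<close> are indexed by \<open>Z\<close>;
  for empty \<open>Z\<close> they are the whole ring.\<close>

definition symbolic_power :: "(p1 \<times> p1) set \<Rightarrow> nat \<Rightarrow> form_ring set" where
  "symbolic_power Z m = (\<Inter>(p, q) \<in> Z. ideal_power (point_ideal p q) m)"

lemma point_ideal_generated: "\<exists>S. point_ideal p q = ideal_gen S"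
proof transfer
  fix p q :: "complex \<times> complex"
  obtain a b c d where "p = (a, b)" "q = (c, d)" by (cases p, cases q)
  then show "\<exists>S. rep_ideal p q = ideal_gen S"
    unfolding rep_ideal_def by (simp only: prod.case) (rule exI, rule refl)
qed

lemma ideal_power_point_ideal_1: "ideal_power (point_ideal p q) 1 = point_ideal p q"
proof -
  interpret module "(*) :: form_ring \<Rightarrow> form_ring \<Rightarrow> form_ring" by (rule module_times)
  obtain S where S: "point_ideal p q = span S"
    using point_ideal_generated[of p q] unfolding ideal_gen_def by blast
  have "{f * g | f g. f \<in> span S \<and> g \<in> UNIV} = span S"
  proof (intro equalityI subsetI)
    fix x assume "x \<in> {f * g | f g. f \<in> span S \<and> g \<in> UNIV}"
    then obtain f g where "x = f * g" and f: "f \<in> span S" by blast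
    then have "x = g * f" by (simp only: mult.commute)
    then show "x \<in> span S" using span_scale[OF f, of g] by (simp only:)
  next
    fix x assume x: "x \<in> span S"
    show "x \<in> {f * g | f g. f \<in> span S \<and> g \<in> UNIV}"
      by (rule CollectI, rule exI[of _ x], rule exI[of _ 1]) (simp add: x)
  qed
  then have "ideal_mult (point_ideal p q) UNIV = point_ideal p q"
    unfolding ideal_mult_def ideal_gen_def S by (simp only: span_span)
  then show ?thesis by (simp only: One_nat_def ideal_power.simps)
qed

lemma symbolic_power_1: "symbolic_power Z 1 = radical_ideal Z"
  unfolding symbolic_power_def radical_ideal_def ideal_power_point_ideal_1 ..

text \<open>Only meaningful if the ideal contains a non-zero form of some bi-degree \<open>(k, k)\<close>,
  as every non-zero bi-homogeneous ideal does.\<close>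

definition alpha_star :: "form_ring set \<Rightarrow> nat" where
  "alpha_star J = (LEAST k. \<exists>F \<in> J. F \<noteq> 0 \<and> bihomogeneous k k F)"

end

theory Submission
  imports Defs
    "HOL-Computational_Algebra.Polynomial_Factorial"
    "HOL-Computational_Algebra.Field_as_Ring"
    "HOL-Computational_Algebra.Fundamental_Theorem_Algebra"
begin

text \<open>
  Move \<open>Z\<close> into an affine chart and let \<open>f(x, y)\<close> be the dehomogenization of a form of bi-degree
  \<open>(k, k)\<close> in \<open>I\<^sup>(\<^sup>m\<^sup>+\<^sup>1\<^sup>)\<close>, where no form of bi-degree \<open>(k - 1, k - 1)\<close> lies in \<open>I\<^sup>(\<^sup>m\<^sup>)\<close>. Suppose \<open>f\<close>
  has an irreducible factor \<open>q\<close> of bi-degree \<open>(a, b)\<close> with \<open>a, b > 0\<close>, and let \<open>\<mu>\<^sub>P\<close> be its multiplicities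
  at the points of \<open>Z\<close>. Bezout's inequality for \<open>q\<close> and \<open>\<partial>q/\<partial>y\<close> gives
  \<open>\<Sum> \<mu>\<^sub>P (\<mu>\<^sub>P - 1) \<le> a (2 b - 1) < 2 a b\<close>, so there are fewer than \<open>a b\<close> linear conditions for a
  polynomial of bi-degree \<open>(a - 1, b - 1)\<close> to vanish to order \<open>\<mu>\<^sub>P - 1\<close> at every \<open>P\<close>, and some \<open>G \<noteq> 0\<close>
  does. Replacing \<open>q\<close> by \<open>G\<close> in \<open>f\<close> lowers both degrees and costs at most one order of vanishing, a
  contradiction. Hence \<open>f = V(x) H(y)\<close>. If \<open>\<xi>\<close> is a root of \<open>V\<close> and \<open>\<eta>\<close> a root of \<open>H\<close>, then dividing by
  \<open>(x - \<xi>) (y - \<eta>)\<close> loses two orders only at \<open>(\<xi>, \<eta>)\<close>, so \<open>(\<xi>, \<eta>)\<close> must be a point of \<open>Z\<close> where \<open>f\<close> has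
  order exactly \<open>m + 1\<close>; it follows that \<open>Z\<close> is the product of the two sets of roots.
\<close>

section \<open>Bivariate polynomials\<close>

text \<open>The outer variable is \<open>y\<close>, the inner one \<open>x\<close>: \<open>coeff (coeff f j) i\<close> belongs to \<open>x\<^sup>i y\<^sup>j\<close>.\<close>

type_synonym bipoly = "complex poly poly"

definition subst1 :: "bipoly \<Rightarrow> complex poly \<Rightarrow> bipoly" where
  "subst1 a p = poly (map_poly (\<lambda>c. [:[:c:]:]) p) a"

text \<open>Both \<open>a\<close> and \<open>b\<close> may involve both variables, so this one
  homomorphism covers translations, the exchange of the variables and the blow-up.\<close>

definition subst2 :: "bipoly \<Rightarrow> bipoly \<Rightarrow> bipoly \<Rightarrow> bipoly" where
  "subst2 a b f = poly (map_poly (subst1 a) f) b"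

lemma subst1_0 [simp]: "subst1 a 0 = 0"
  by (simp add: subst1_def)

lemma subst1_pCons [simp]: "subst1 a (pCons c p) = [:[:c:]:] + a * subst1 a p"
  by (simp add: subst1_def map_poly_pCons)

lemma subst1_1 [simp]: "subst1 a 1 = 1"
  by (simp add: one_pCons)

lemma subst2_0 [simp]: "subst2 a b 0 = 0"
  by (simp add: subst2_def)

lemma subst2_pCons [simp]: "subst2 a b (pCons p f) = subst1 a p + b * subst2 a b f"
  by (simp add: subst2_def map_poly_pCons)

lemma subst1_add: "subst1 a (p + q) = subst1 a p + subst1 a q"
  by (induction p q rule: poly_induct2) (simp_all add: algebra_simps)

lemma subst1_smult: "subst1 a (smult c p) = [:[:c:]:] * subst1 a p"
  by (induction p) (simp_all add: algebra_simps)

lemma subst1_mult: "subst1 a (p * q) = subst1 a p * subst1 a q"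
  by (induction p) (simp_all add: subst1_add subst1_smult algebra_simps)

lemma subst2_add: "subst2 a b (f + g) = subst2 a b f + subst2 a b g"
  by (induction f g rule: poly_induct2) (simp_all add: subst1_add algebra_simps)

lemma subst2_smult: "subst2 a b (smult p f) = subst1 a p * subst2 a b f"
  by (induction f) (simp_all add: subst1_mult algebra_simps)

lemma subst2_mult: "subst2 a b (f * g) = subst2 a b f * subst2 a b g"
  by (induction f) (simp_all add: subst2_add subst2_smult algebra_simps)

lemma subst2_const [simp]: "subst2 a b [:[:c:]:] = [:[:c:]:]"
  by simp

lemma subst2_1 [simp]: "subst2 a b 1 = 1"
  by (simp add: one_pCons)

lemma subst2_minus: "subst2 a b (- f) = - subst2 a b f"
  using subst2_add[of a b f "- f"] by (simp add: eq_neg_iff_add_eq_0 add.commute)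

lemma subst2_diff: "subst2 a b (f - g) = subst2 a b f - subst2 a b g"
  using subst2_add[of a b f "- g"] by (simp add: subst2_minus)

lemma subst2_power: "subst2 a b (f ^ n) = subst2 a b f ^ n"
  by (induction n) (simp_all add: subst2_mult)

lemma subst2_sum: "subst2 a b (\<Sum>i\<in>I. f i) = (\<Sum>i\<in>I. subst2 a b (f i))"
  by (induction I rule: infinite_finite_induct) (simp_all add: subst2_add)

lemma subst2_prod: "subst2 a b (\<Prod>i\<in>I. f i) = (\<Prod>i\<in>I. subst2 a b (f i))"
  by (induction I rule: infinite_finite_induct) (simp_all add: subst2_mult)

lemmas subst2_hom = subst2_smult subst2_add subst2_mult subst2_minus subst2_diff subst2_power subst2_sum subst2_prod

lemma subst2_subst1: "subst2 a b (subst1 c p) = subst1 (subst2 a b c) p"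
  by (induction p) (simp_all add: subst2_add subst2_mult del: subst2_pCons)

lemma subst2_subst2: "subst2 a b (subst2 c d f) = subst2 (subst2 a b c) (subst2 a b d) f"
  by (induction f) (simp_all add: subst2_add subst2_mult subst2_subst1)

lemma subst1_xx [simp]: "subst1 [:[:0, 1:]:] p = [:p:]"
  by (induction p) simp_all

lemma subst2_id [simp]: "subst2 [:[:0, 1:]:] [:0, 1:] f = f"
  by (induction f) simp_all

lemma subst1_yy: "subst1 [:0, 1:] p = map_poly (\<lambda>c. [:c:]) p"
  by (induction p) (simp_all add: map_poly_pCons)

section \<open>Exchange of the variables and bi-degree\<close>

definition swap :: "bipoly \<Rightarrow> bipoly" where
  "swap = subst2 [:0, 1:] [:[:0, 1:]:]"

lemma coeff_swap: "coeff (coeff (swap f) i) j = coeff (coeff f j) i"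
  unfolding swap_def
  by (induction f arbitrary: i j)
    (auto simp: subst1_yy coeff_map_poly coeff_pCons split: nat.split)

lemma swap_swap [simp]: "swap (swap f) = f"
  by (intro poly_eqI) (simp add: coeff_swap)

lemma swap_mult: "swap (f * g) = swap f * swap g"
  by (simp add: swap_def subst2_mult)

lemma swap_eq_0_iff [simp]: "swap f = 0 \<longleftrightarrow> f = 0"
  by (metis swap_swap subst2_0 swap_def)

text \<open>Upper bounds instead of exact degrees: they cut out a vector space, as the dimension
  counts below require.\<close>

definition bideg :: "nat \<Rightarrow> nat \<Rightarrow> bipoly \<Rightarrow> bool" where
  "bideg k l f \<longleftrightarrow> degree (swap f) \<le> k \<and> degree f \<le> l"

lemma bideg_iff: "bideg k l f \<longleftrightarrow> (\<forall>i j. coeff (coeff f j) i \<noteq> 0 \<longrightarrow> i \<le> k \<and> j \<le> l)"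
proof -
  have 1: "degree h \<le> n \<longleftrightarrow> (\<forall>i j. coeff (coeff h i) j \<noteq> 0 \<longrightarrow> i \<le> n)" for h :: bipoly and n
  proof
    assume "degree h \<le> n"
    then show "\<forall>i j. coeff (coeff h i) j \<noteq> 0 \<longrightarrow> i \<le> n"
      by (metis coeff_0 le_degree order_trans)
  next
    assume "\<forall>i j. coeff (coeff h i) j \<noteq> 0 \<longrightarrow> i \<le> n"
    then have "coeff h i = 0" if "i > n" for i
      using that by (intro poly_eqI) (metis coeff_0 not_le)
    then show "degree h \<le> n"
      by (simp add: degree_le)
  qed
  show ?thesis
    unfolding bideg_def 1 by (auto simp: coeff_swap)
qed

lemma bideg_mono: "bideg k l f \<Longrightarrow> k \<le> k' \<Longrightarrow> l \<le> l' \<Longrightarrow> bideg k' l' f"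
  by (auto simp: bideg_def)

lemma bideg_mult: "bideg k l f \<Longrightarrow> bideg k' l' g \<Longrightarrow> bideg (k + k') (l + l') (f * g)"
  unfolding bideg_def swap_mult by (meson add_mono degree_mult_le order_trans)

lemma bideg_0 [simp]: "bideg k l 0"
  by (simp add: bideg_iff)

lemma bideg_add: "bideg k l f \<Longrightarrow> bideg k l g \<Longrightarrow> bideg k l (f + g)"
  unfolding bideg_def swap_def subst2_add by (auto intro: degree_add_le)

lemma bideg_sum: "(\<And>i. i \<in> I \<Longrightarrow> bideg k l (f i)) \<Longrightarrow> bideg k l (\<Sum>i\<in>I. f i)"
  by (induction I rule: infinite_finite_induct) (auto intro: bideg_add)

lemma bideg_const [simp]: "bideg k l [:[:c:]:]"
  by (auto simp: bideg_iff coeff_pCons split: nat.splits)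

lemma bideg_1 [simp]: "bideg k l 1"
  by (simp add: one_pCons)

lemma bideg_power: "bideg k l f \<Longrightarrow> bideg (n * k) (n * l) (f ^ n)"
  by (induction n) (auto dest: bideg_mult)

lemma bideg_prod:
  "(\<And>i. i \<in> I \<Longrightarrow> bideg (k i) (l i) (f i)) \<Longrightarrow> bideg (\<Sum>i\<in>I. k i) (\<Sum>i\<in>I. l i) (\<Prod>i\<in>I. f i)"
  by (induction I rule: infinite_finite_induct) (auto intro: bideg_mult)

lemma bideg_lin_x [simp]: "bideg (Suc 0) 0 [:[:a, b:]:]"
  by (auto simp: bideg_iff coeff_pCons split: nat.splits)

lemma bideg_lin_y [simp]: "bideg 0 (Suc 0) [:[:a:], [:b:]:]" "bideg 0 (Suc 0) [:[:a:], 1:]"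
  by (auto simp: bideg_iff coeff_pCons one_pCons split: nat.splits if_splits)

lemma bideg_mult_D:
  assumes "bideg k l (f * g)" "f * g \<noteq> 0"
  shows "bideg (k - degree (swap f)) (l - degree f) g"
  using assms by (auto simp: bideg_def swap_mult degree_mult_eq)

lemma bipoly_expand:
  assumes "bideg k l f"
  shows "f = (\<Sum>j\<le>l. \<Sum>i\<le>k. [:[:coeff (coeff f j) i:]:] * [:[:0, 1:]:] ^ i * [:0, 1:] ^ j)"
    (is "f = ?r")
proof (intro poly_eqI)
  fix j i
  have m: "[:[:c:]:] * [:[:0, 1:]:] ^ i * [:0, 1:] ^ j = monom (monom c i) j" for c :: complex and i j
    by (simp add: monom_altdef poly_const_pow)
  have "coeff (coeff ?r j) i = (\<Sum>j'\<le>l. \<Sum>i'\<le>k. if j' = j then if i' = i then coeff (coeff f j) i else 0 else 0)"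
    unfolding m by (simp add: coeff_sum if_distrib[of "\<lambda>p. coeff p i"] cong: if_cong)
  also have "\<dots> = (if j \<le> l \<and> i \<le> k then coeff (coeff f j) i else 0)"
  proof -
    have "(\<Sum>i'\<le>k. if j' = j then if i' = i then coeff (coeff f j) i else 0 else 0)
      = (if j' = j then if i \<le> k then coeff (coeff f j) i else 0 else 0)" for j'
      by simp
    then show ?thesis by simp
  qed
  also have "\<dots> = coeff (coeff f j) i"
    using assms by (auto simp: bideg_iff)
  finally show "coeff (coeff f j) i = coeff (coeff ?r j) i" ..
qed

section \<open>Translation and Taylor expansion\<close>

definition translate :: "complex \<times> complex \<Rightarrow> bipoly \<Rightarrow> bipoly" where
  "translate P = subst2 [:[:fst P, 1:]:] [:[:snd P:], 1:]"

lemma translate_inverse: "translate (- a, - c) (translate (a, c) f) = f"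
proof -
  have "translate (- a, - c) (translate (a, c) f) = subst2 [:[:0, 1:]:] [:0, 1:] f"
    unfolding translate_def subst2_subst2 by simp
  then show ?thesis by simp
qed

lemma translate_eq_0_iff [simp]: "translate P f = 0 \<longleftrightarrow> f = 0"
  by (metis translate_inverse prod.collapse subst2_0 translate_def)

lemma bideg_translate: "bideg k l f \<Longrightarrow> bideg k l (translate P f)"
proof -
  assume f: "bideg k l f"
  have "bideg k l ([:[:c:]:] * [:[:fst P, 1:]:] ^ i * [:[:snd P:], 1:] ^ j)"
    if "i \<le> k" "j \<le> l" for c i j
  proof -
    have "bideg (0 + i * Suc 0 + j * 0) (0 + i * 0 + j * Suc 0)
      ([:[:c:]:] * [:[:fst P, 1:]:] ^ i * [:[:snd P:], 1:] ^ j)"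
      by (intro bideg_mult bideg_power bideg_lin_x bideg_lin_y bideg_const)
    then show ?thesis using that by (auto elim: bideg_mono)
  qed
  then show ?thesis
    by (subst bipoly_expand[OF f]) (auto simp: translate_def subst2_hom intro!: bideg_sum)
qed

lemma taylor_expand:
  assumes "bideg k l f"
  shows "f = (\<Sum>j\<le>l. \<Sum>i\<le>k. [:[:coeff (coeff (translate (a, c) f) j) i:]:]
    * [:[:- a, 1:]:] ^ i * [:[:- c:], 1:] ^ j)"
proof -
  have "f = translate (- a, - c) (translate (a, c) f)"
    by (simp add: translate_inverse)
  also have "\<dots> = (\<Sum>j\<le>l. \<Sum>i\<le>k. [:[:coeff (coeff (translate (a, c) f) j) i:]:]
    * [:[:- a, 1:]:] ^ i * [:[:- c:], 1:] ^ j)"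
    by (subst bipoly_expand[OF bideg_translate[OF assms, of "(a, c)"]])
      (simp add: translate_def[of "(-a, -c)"] subst2_hom)
  finally show ?thesis .
qed

section \<open>Order of vanishing\<close>

definition vanish :: "nat \<Rightarrow> complex \<times> complex \<Rightarrow> bipoly \<Rightarrow> bool" where
  "vanish m P f \<longleftrightarrow> (\<forall>i j. i + j < m \<longrightarrow> coeff (coeff (translate P f) j) i = 0)"

text \<open>Substituting \<open>x = t\<close>, \<open>y = t w\<close> (outer variable \<open>t\<close>, inner \<open>w\<close>) turns the order of vanishing at
  the origin into the exponent of \<open>t\<close>, which makes it additive on products.\<close>

definition blowup :: "bipoly \<Rightarrow> bipoly" where
  "blowup = subst2 [:0, 1:] [:0, [:0, 1:]:]"

lemma coeff_blowup:
  "coeff (coeff (blowup f) n) j = (if j \<le> n then coeff (coeff f j) (n - j) else 0)"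
  unfolding blowup_def
  by (induction f arbitrary: n j)
    (auto simp: subst1_yy coeff_map_poly coeff_pCons split: nat.split)

lemma blowup_eq_0_iff [simp]: "blowup f = 0 \<longleftrightarrow> f = 0"
proof
  assume "blowup f = 0"
  then have "coeff (coeff f j) i = 0" for i j
    using coeff_blowup[of f "i + j" j] by simp
  then show "f = 0" by (intro poly_eqI) simp
qed (simp add: blowup_def)

text \<open>Without meaning for \<open>f = 0\<close>, like \<open>order\<close>. Hence
  \<open>vanish\<close> is used where sums occur and \<open>mult_at\<close> for products of non-zero
  polynomials.\<close>

definition mult_at :: "complex \<times> complex \<Rightarrow> bipoly \<Rightarrow> nat" where
  "mult_at P f = order 0 (blowup (translate P f))"

text \<open>The coefficient of \<open>t ^ n\<close> in the blow-up collects the terms of total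
  degree \<open>n\<close>; there they carry different powers of \<open>w\<close>, so they cannot
  cancel.\<close>

lemma vanish_iff_dvd: "vanish m P f \<longleftrightarrow> monom 1 m dvd blowup (translate P f)"
proof -
  have "monom 1 m dvd blowup (translate P f) \<longleftrightarrow>
      (\<forall>n<m. \<forall>j. coeff (coeff (blowup (translate P f)) n) j = 0)"
    by (simp add: monom_1_dvd_iff' poly_eq_iff)
  also have "\<dots> \<longleftrightarrow> vanish m P f"
    unfolding vanish_def coeff_blowup
    by (metis (no_types, lifting) add_diff_cancel_right' le_add2 le_add_diff_inverse2)
  finally show ?thesis ..
qed

lemma vanish_iff_mult_at: "f \<noteq> 0 \<Longrightarrow> vanish m P f \<longleftrightarrow> m \<le> mult_at P f"
  by (simp add: vanish_iff_dvd mult_at_def monom_1_dvd_iff)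

lemma mult_at_mult: "f * g \<noteq> 0 \<Longrightarrow> mult_at P (f * g) = mult_at P f + mult_at P g"
proof -
  assume "f * g \<noteq> 0"
  moreover have "blowup (translate P (f * g)) = blowup (translate P f) * blowup (translate P g)"
    by (simp add: blowup_def translate_def subst2_mult)
  ultimately show ?thesis
    unfolding mult_at_def by (simp add: order_mult)
qed

lemma vanish_0 [simp]: "vanish m P 0"
  by (simp add: vanish_def translate_def)

lemma vanish_trivial [simp]: "vanish 0 P f"
  by (simp add: vanish_def)

lemma vanish_add: "vanish m P f \<Longrightarrow> vanish m P g \<Longrightarrow> vanish m P (f + g)"
  by (simp add: vanish_def translate_def subst2_add)

lemma vanish_minus: "vanish m P f \<Longrightarrow> vanish m P (- f)"
  by (simp add: vanish_def translate_def subst2_minus)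

lemma vanish_sum: "(\<And>i. i \<in> I \<Longrightarrow> vanish m P (f i)) \<Longrightarrow> vanish m P (\<Sum>i\<in>I. f i)"
  by (induction I rule: infinite_finite_induct) (auto intro: vanish_add)

lemma vanish_mult: "vanish m P f \<Longrightarrow> vanish n P g \<Longrightarrow> vanish (m + n) P (f * g)"
proof -
  assume "vanish m P f" "vanish n P g"
  then have "monom 1 m * monom 1 n dvd blowup (translate P f) * blowup (translate P g)"
    unfolding vanish_iff_dvd by (rule mult_dvd_mono)
  then show ?thesis
    by (simp add: vanish_iff_dvd mult_monom blowup_def translate_def subst2_mult)
qed

lemma vanish_mult_left: "vanish m P f \<Longrightarrow> vanish m P (f * g)"
  using vanish_mult[of m P f 0 g] by simp

lemma vanish_mult_right: "vanish m P g \<Longrightarrow> vanish m P (f * g)"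
  using vanish_mult[of 0 P f m g] by simp

lemma vanish_power: "vanish m P f \<Longrightarrow> vanish (n * m) P (f ^ n)"
  by (induction n) (auto dest: vanish_mult)

lemma vanish_prod: "finite I \<Longrightarrow> i \<in> I \<Longrightarrow> vanish m P (f i) \<Longrightarrow> vanish m P (\<Prod>i\<in>I. f i)"
  by (simp add: prod.remove vanish_mult_left del: prod.insert)

lemma pderiv_subst1: "pderiv (subst1 [:[:a, 1:]:] p) = 0"
  by (induction p) (simp_all add: pderiv_add pderiv_mult pderiv_pCons pderiv_smult)

lemma translate_pderiv: "translate P (pderiv f) = pderiv (translate P f)"
proof -
  have "subst2 [:[:a, 1:]:] [:[:c:], 1:] (pderiv f) = pderiv (subst2 [:[:a, 1:]:] [:[:c:], 1:] f)"
    for a c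
  proof (induction f)
    case (pCons p f)
    have "pderiv (subst2 [:[:a, 1:]:] [:[:c:], 1:] (pCons p f)) =
        pderiv ([:[:c:], 1:] * subst2 [:[:a, 1:]:] [:[:c:], 1:] f)"
      by (simp only: subst2_pCons pderiv_add pderiv_subst1 add_0)
    also have "\<dots> = [:[:c:], 1:] * pderiv (subst2 [:[:a, 1:]:] [:[:c:], 1:] f)
        + subst2 [:[:a, 1:]:] [:[:c:], 1:] f"
      by (simp only: pderiv_mult) (simp add: pderiv_pCons)
    also have "\<dots> = subst2 [:[:a, 1:]:] [:[:c:], 1:] (pderiv (pCons p f))"
      by (simp only: pderiv_pCons subst2_add subst2_pCons pCons subst1_0) (simp add: add.commute)
    finally show ?case ..
  qed simp
  then show ?thesis by (simp add: translate_def)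
qed

text \<open>Differentiation in the outer variable y commutes with translation and shifts the Taylor
  coefficients by one place, up to non-zero factors.\<close>

lemma vanish_pderiv: "vanish m P f \<Longrightarrow> vanish (m - 1) P (pderiv f)"
proof -
  have "coeff (coeff (pderiv h) j) i = of_nat (Suc j) * coeff (coeff h (Suc j)) i"
    for h :: bipoly and i j
    unfolding coeff_pderiv of_nat_poly by simp
  then show "vanish m P f \<Longrightarrow> ?thesis"
    by (simp add: vanish_def translate_pderiv)
qed

lemma translate_lin_x: "translate P [:[:- a, 1:]:] = [:[:fst P - a, 1:]:]"
  by (simp add: translate_def)

lemma translate_lin_y: "translate P [:[:- c:], 1:] = [:[:snd P - c:], 1:]"
  by (simp add: translate_def)

lemma vanish_lin_x: "vanish 1 (a, c) [:[:- a, 1:]:]"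
  by (simp add: vanish_def translate_lin_x)

lemma vanish_lin_y: "vanish 1 (a, c) [:[:- c:], 1:]"
  by (simp add: vanish_def translate_lin_y)

text \<open>In the blow-up a vertical or horizontal line through the origin becomes \<open>t\<close>
  or \<open>t * w\<close>; \<open>u\<close> is the cofactor.\<close>

lemma order_0_linear: "u \<noteq> 0 \<Longrightarrow> order 0 [:0, u:] = 1" for u :: "'a::idom"
  using order_smult[of u 0 "[:0, 1:]"] order_power_n_n[of "0::'a" 1] by simp

lemma mult_at_lin_x: "mult_at P [:[:- a, 1:]:] = (if fst P = a then 1 else 0)"
  by (auto simp: mult_at_def translate_lin_x blowup_def order_0_linear intro!: order_0I)

lemma mult_at_lin_y: "mult_at P [:[:- c:], 1:] = (if snd P = c then 1 else 0)"
  by (auto simp: mult_at_def translate_lin_y blowup_def order_0_linear intro!: order_0I)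

section \<open>Interpolation by counting conditions\<close>

text \<open>Gaussian elimination, one equation at a time; \<open>M i j\<close> is the coefficient of
  the unknown \<open>i\<close> in the equation \<open>j\<close>.\<close>

lemma underdetermined_system:
  fixes M :: "'i \<Rightarrow> 'j \<Rightarrow> 'a::field"
  assumes "finite J" "finite I" "card J < card I"
  shows "\<exists>c. (\<exists>i\<in>I. c i \<noteq> 0) \<and> (\<forall>j\<in>J. (\<Sum>i\<in>I. c i * M i j) = 0)"
  using assms
proof (induction J arbitrary: I M rule: finite_induct)
  case empty
  then have "I \<noteq> {}" by auto
  then show ?case by (intro exI[of _ "\<lambda>_. 1"]) auto
next
  case (insert j J)
  show ?case
  proof (cases "\<forall>i\<in>I. M i j = 0")
    case True
    have "card J < card I"
      using insert.hyps insert.prems by simp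
    from insert.IH[OF insert.prems(1) this, of M] True show ?thesis
      by auto
  next
    case False
    then obtain i0 where i0: "i0 \<in> I" "M i0 j \<noteq> 0" by auto
    define I' where "I' = I - {i0}"
    have I': "finite I'" "card J < card I'"
      using insert.hyps insert.prems i0 by (auto simp: I'_def card_Diff_singleton)
    \<comment> \<open>Equation \<open>j\<close> is solved for the unknown \<open>i0\<close>, and the
      result is substituted into the remaining equations.\<close>
    define M' where "M' i j' = M i j' - M i j / M i0 j * M i0 j'" for i j'
    obtain c' where c': "\<exists>i\<in>I'. c' i \<noteq> 0" "\<And>j'. j' \<in> J \<Longrightarrow> (\<Sum>i\<in>I'. c' i * M' i j') = 0"
      using insert.IH[OF I', of M'] by blast
    define s where "s = (\<Sum>i\<in>I'. c' i * M i j)"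
    define c where "c = c'(i0 := - s / M i0 j)"
    have split: "(\<Sum>i\<in>I. c i * M i j') = - s / M i0 j * M i0 j' + (\<Sum>i\<in>I'. c' i * M i j')" for j'
    proof -
      have "(\<Sum>i\<in>I. c i * M i j') = c i0 * M i0 j' + (\<Sum>i\<in>I'. c i * M i j')"
        unfolding I'_def using i0 insert.prems by (simp add: sum.remove)
      moreover have "(\<Sum>i\<in>I'. c i * M i j') = (\<Sum>i\<in>I'. c' i * M i j')"
        by (intro sum.cong) (auto simp: c_def I'_def)
      ultimately show ?thesis by (simp add: c_def)
    qed
    have "(\<Sum>i\<in>I. c i * M i j) = 0"
      unfolding split using i0 by (simp add: s_def)
    moreover have "(\<Sum>i\<in>I. c i * M i j') = 0" if "j' \<in> J" for j'
    proof -
      have "0 = (\<Sum>i\<in>I'. c' i * M' i j')" using c'(2)[OF that] by simp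
      also have "\<dots> = (\<Sum>i\<in>I'. c' i * M i j') - (\<Sum>i\<in>I'. c' i * M i j * (M i0 j' / M i0 j))"
        unfolding sum_subtractf[symmetric]
        by (intro sum.cong) (auto simp: M'_def algebra_simps)
      also have "\<dots> = (\<Sum>i\<in>I'. c' i * M i j') - s * (M i0 j' / M i0 j)"
        unfolding s_def sum_distrib_right ..
      finally show ?thesis
        unfolding split by (simp add: field_simps)
    qed
    moreover have "\<exists>i\<in>I. c i \<noteq> 0"
      using c'(1) by (auto simp: c_def I'_def)
    ultimately show ?thesis by blast
  qed
qed

text \<open>The exponents of the Taylor terms below order \<open>n\<close>: vanishing to order
  \<open>n\<close> is one linear condition for each.\<close>

definition triangle :: "nat \<Rightarrow> (nat \<times> nat) set" where
  "triangle n = {(i, j). i + j < n}"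

lemma triangle_altdef: "triangle n = (SIGMA i:{..<n}. {..<n - i})"
  by (auto simp: triangle_def)

lemma finite_triangle [simp]: "finite (triangle n)"
  by (simp add: triangle_altdef)

lemma card_triangle: "2 * card (triangle n) = n * (n + 1)"
proof -
  have "card (triangle n) = (\<Sum>i<n. n - i)"
    by (simp add: triangle_altdef)
  also have "\<dots> = (\<Sum>i<n. Suc i)"
    by (rule sum.reindex_bij_witness[of _ "\<lambda>i. n - 1 - i" "\<lambda>i. n - 1 - i"]) auto
  also have "2 * \<dots> = n * (n + 1)"
    by (induction n) auto
  finally show ?thesis .
qed

abbreviation (input) bmonom :: "nat \<Rightarrow> nat \<Rightarrow> bipoly" where
  "bmonom i j \<equiv> monom (monom 1 i) j"

lemma bideg_bmonom: "i \<le> k \<Longrightarrow> j \<le> l \<Longrightarrow> bideg k l (bmonom i j)"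
  by (auto simp: bideg_iff)

lemma bideg_bconst_mult: "bideg k l f \<Longrightarrow> bideg k l ([:[:c:]:] * f)"
  by (auto simp: bideg_iff)

lemma coeff_lincomb_bmonom:
  assumes "finite I"
  shows "coeff (coeff (\<Sum>(i, j)\<in>I. [:[:c (i, j):]:] * bmonom i j) s) r = (if (r, s) \<in> I then c (r, s) else 0)"
proof -
  have "coeff (coeff (\<Sum>(i, j)\<in>I. [:[:c (i, j):]:] * bmonom i j) s) r
      = (\<Sum>x\<in>I. if x = (r, s) then c x else 0)"
    unfolding coeff_sum by (intro sum.cong) (auto split: if_splits)
  then show ?thesis using assms by simp
qed

lemma coeff_translate_lincomb:
  "coeff (coeff (translate P (\<Sum>x\<in>I. [:[:c x:]:] * b x)) s) r
    = (\<Sum>x\<in>I. c x * coeff (coeff (translate P (b x)) s) r)"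
  by (simp add: translate_def subst2_hom coeff_sum)

text \<open>The unknowns are the coefficients of the \<open>k * l\<close> monomials, the equations
  the Taylor coefficients to be killed. The strict inequality forces \<open>k\<close> and
  \<open>l\<close> to be positive, so the degree bounds are not truncated.\<close>

lemma exists_vanishing:
  assumes "finite A" "(\<Sum>P\<in>A. card (triangle (n P))) < k * l"
  shows "\<exists>G. G \<noteq> 0 \<and> bideg (k - 1) (l - 1) G \<and> (\<forall>P\<in>A. vanish (n P) P G)"
proof -
  let ?I = "{..<k} \<times> {..<l}" and ?J = "SIGMA P:A. triangle (n P)"
  have "card ?J < card ?I"
    using assms by (simp add: card_SigmaI)
  moreover have "finite ?J" using assms by (intro finite_SigmaI) auto
  ultimately obtain c where c: "\<exists>x\<in>?I. c x \<noteq> 0"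
    "\<forall>y\<in>?J. (\<Sum>x\<in>?I. c x * (case x of (i, j) \<Rightarrow> case y of (P, r, s) \<Rightarrow>
        coeff (coeff (translate P (bmonom i j)) s) r)) = 0"
    using underdetermined_system[of ?J ?I "\<lambda>x y. case x of (i, j) \<Rightarrow> case y of (P, r, s) \<Rightarrow>
        coeff (coeff (translate P (bmonom i j)) s) r"] by auto
  define G where "G = (\<Sum>(i, j)\<in>?I. [:[:c (i, j):]:] * bmonom i j)"
  have G': "G = (\<Sum>x\<in>?I. [:[:c x:]:] * (case x of (i, j) \<Rightarrow> bmonom i j))"
    unfolding G_def by (intro sum.cong) auto
  have coeff_G: "coeff (coeff G s) r = (if (r, s) \<in> ?I then c (r, s) else 0)" for r s
    unfolding G_def by (rule coeff_lincomb_bmonom) simp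
  have "G \<noteq> 0"
  proof -
    obtain i j where "(i, j) \<in> ?I" "c (i, j) \<noteq> 0" using c(1) by blast
    then have "coeff (coeff G j) i \<noteq> 0" unfolding coeff_G by simp
    then show ?thesis by auto
  qed
  moreover have "bideg (k - 1) (l - 1) G"
    unfolding bideg_iff coeff_G by auto
  moreover have "vanish (n P) P G" if "P \<in> A" for P
    unfolding vanish_def
  proof (intro allI impI)
    fix r s assume "r + s < n P"
    then have "(P, r, s) \<in> ?J" using that by (auto simp: triangle_def)
    from c(2)[rule_format, OF this] show "coeff (coeff (translate P G) s) r = 0"
      unfolding G' coeff_translate_lincomb by (simp add: case_prod_beta)
  qed
  ultimately show ?thesis by blast
qed

section \<open>Interpolation basis for jets at finitely many points\<close>

lemma mult_at_1 [simp]: "mult_at P 1 = 0"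
proof -
  have "blowup (translate P 1) = 1" by (simp add: blowup_def translate_def)
  then show ?thesis unfolding mult_at_def by (simp add: order_0I)
qed

lemma mult_at_power: "f \<noteq> 0 \<Longrightarrow> mult_at P (f ^ n) = n * mult_at P f"
  by (induction n) (simp_all add: mult_at_mult)

lemma mult_at_prod:
  assumes "\<And>i. i \<in> I \<Longrightarrow> f i \<noteq> 0"
  shows "mult_at P (\<Prod>i\<in>I. f i) = (\<Sum>i\<in>I. mult_at P (f i))"
  using assms by (induction I rule: infinite_finite_induct) (simp_all add: mult_at_mult)

text \<open>Points on the vertical line through \<open>P\<close> are separated by horizontal lines, which is what keeps the degree
  in \<open>y\<close> small.\<close>

definition separator :: "(complex \<times> complex) set \<Rightarrow> (complex \<times> complex \<Rightarrow> nat) \<Rightarrow> complex \<times> complex \<Rightarrow> bipoly" where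
  "separator A N P = (\<Prod>R\<in>{R \<in> A. fst R \<noteq> fst P}. [:[:- fst R, 1:]:] ^ N R)
    * (\<Prod>R\<in>{R \<in> A. fst R = fst P \<and> R \<noteq> P}. [:[:- snd R:], 1:] ^ N R)"

lemma separator_neq_0: "finite A \<Longrightarrow> separator A N P \<noteq> 0"
  by (simp add: separator_def)

lemma mult_at_separator:
  assumes "finite A"
  shows "mult_at P (separator A N P) = 0"
  using separator_neq_0[OF assms, of N P] assms unfolding separator_def
  by (subst mult_at_mult)
    (auto simp: mult_at_prod mult_at_power mult_at_lin_x mult_at_lin_y prod_eq_iff)

lemma vanish_separator:
  assumes "finite A" "R \<in> A" "R \<noteq> P"
  shows "vanish (N R) R (separator A N P)"
proof (cases "fst R = fst P")
  case True
  have "vanish (N R * 1) R ([:[:- snd R:], 1:] ^ N R)"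
    using vanish_lin_y[of "fst R" "snd R"] by (intro vanish_power) simp
  then have "vanish (N R) R (\<Prod>R\<in>{R \<in> A. fst R = fst P \<and> R \<noteq> P}. [:[:- snd R:], 1:] ^ N R)"
    using assms True by (intro vanish_prod) auto
  then show ?thesis unfolding separator_def by (rule vanish_mult_right)
next
  case False
  have "vanish (N R * 1) R ([:[:- fst R, 1:]:] ^ N R)"
    using vanish_lin_x[of "fst R" "snd R"] by (intro vanish_power) simp
  then have "vanish (N R) R (\<Prod>R\<in>{R \<in> A. fst R \<noteq> fst P}. [:[:- fst R, 1:]:] ^ N R)"
    using assms False by (intro vanish_prod) auto
  then show ?thesis unfolding separator_def by (rule vanish_mult_left)
qed

lemma bideg_separator:
  "bideg (\<Sum>R\<in>{R \<in> A. fst R \<noteq> fst P}. N R) (\<Sum>R\<in>{R \<in> A. fst R = fst P \<and> R \<noteq> P}. N R) (separator A N P)"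
proof -
  have "bideg (\<Sum>R\<in>{R \<in> A. fst R \<noteq> fst P}. N R * Suc 0) (\<Sum>R\<in>{R \<in> A. fst R \<noteq> fst P}. N R * 0)
      (\<Prod>R\<in>{R \<in> A. fst R \<noteq> fst P}. [:[:- fst R, 1:]:] ^ N R)"
    by (intro bideg_prod bideg_power bideg_lin_x)
  moreover have "bideg (\<Sum>R\<in>{R \<in> A. fst R = fst P \<and> R \<noteq> P}. N R * 0) (\<Sum>R\<in>{R \<in> A. fst R = fst P \<and> R \<noteq> P}. N R * Suc 0)
      (\<Prod>R\<in>{R \<in> A. fst R = fst P \<and> R \<noteq> P}. [:[:- snd R:], 1:] ^ N R)"
    by (intro bideg_prod bideg_power bideg_lin_y)
  ultimately show ?thesis
    unfolding separator_def by (auto dest: bideg_mult)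
qed

text \<open>Near \<open>P\<close> the summands of all other points vanish to order
  \<open>N P\<close>. The separator of \<open>P\<close> does not vanish at \<open>P\<close>, so
  cancelling it leaves a Taylor polynomial of degree below \<open>N P\<close> that vanishes to order
  \<open>N P\<close>.\<close>

lemma separators_independent:
  assumes "finite A"
    and w: "w = (\<Sum>(P, i, j)\<in>(SIGMA P:A. triangle (N P)).
      [:[:c (P, i, j):]:] * ([:[:- fst P, 1:]:] ^ i * [:[:- snd P:], 1:] ^ j * separator A N P))"
    and van: "\<And>P. P \<in> A \<Longrightarrow> vanish (N P) P w"
    and P: "P \<in> A" "(i, j) \<in> triangle (N P)"
  shows "c (P, i, j) = 0"
proof -
  define v where "v P = (\<Sum>(i, j)\<in>triangle (N P). [:[:c (P, i, j):]:] * ([:[:- fst P, 1:]:] ^ i * [:[:- snd P:], 1:] ^ j))" for P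
  have "w = (\<Sum>P\<in>A. \<Sum>(i, j)\<in>triangle (N P).
      [:[:c (P, i, j):]:] * ([:[:- fst P, 1:]:] ^ i * [:[:- snd P:], 1:] ^ j * separator A N P))"
    unfolding w using \<open>finite A\<close> by (subst sum.Sigma) auto
  also have "\<dots> = (\<Sum>P\<in>A. v P * separator A N P)"
    unfolding v_def by (simp add: sum_distrib_right case_prod_beta mult.assoc)
  also have "\<dots> = v P * separator A N P + (\<Sum>R\<in>A - {P}. v R * separator A N R)"
    using P \<open>finite A\<close> by (simp add: sum.remove)
  finally have "v P * separator A N P = w + - (\<Sum>R\<in>A - {P}. v R * separator A N R)"
    by simp
  moreover have "vanish (N P) P (\<Sum>R\<in>A - {P}. v R * separator A N R)"
    using P \<open>finite A\<close> by (intro vanish_sum vanish_mult_right vanish_separator) auto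
  ultimately have "vanish (N P) P (v P * separator A N P)"
    using van[OF P(1)] by (metis vanish_add vanish_minus)
  then have "vanish (N P) P (v P)"
    using separator_neq_0[OF \<open>finite A\<close>, of N P] mult_at_separator[OF \<open>finite A\<close>, of P N]
    by (cases "v P = 0") (auto simp: vanish_iff_mult_at mult_at_mult)
  moreover have "translate P (v P) = (\<Sum>(i, j)\<in>triangle (N P). [:[:c (P, i, j):]:] * bmonom i j)"
  proof -
    have "translate P ([:[:d:]:] * ([:[:- fst P, 1:]:] ^ i * [:[:- snd P:], 1:] ^ j)) = [:[:d:]:] * bmonom i j"
      for d i j
    proof -
      have "translate P ([:[:d:]:] * ([:[:- fst P, 1:]:] ^ i * [:[:- snd P:], 1:] ^ j))
          = [:[:d:]:] * ([:[:0, 1:]:] ^ i * [:0, 1:] ^ j)"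
        by (simp only: translate_def subst2_mult subst2_power) simp
      then show ?thesis by (simp add: monom_altdef poly_const_pow)
    qed
    then show ?thesis
      unfolding v_def by (simp only: translate_def subst2_sum case_prod_unfold)
  qed
  ultimately show ?thesis
    using P(2) coeff_lincomb_bmonom[OF finite_triangle, of "\<lambda>(i, j). c (P, i, j)" "N P" j i]
    by (auto simp: vanish_def triangle_def)
qed

section \<open>Restriction to a vertical line\<close>

lemma pcompose_eval_x:
  "map_poly (\<lambda>p. coeff p 0) (translate (a, c) f) = map_poly (\<lambda>p. poly p a) f \<circ>\<^sub>p [:c, 1:]"
proof -
  have hom: "map_poly (\<lambda>p. coeff p 0) (f + g) = map_poly (\<lambda>p. coeff p 0) f + map_poly (\<lambda>p. coeff p 0) g"
    "map_poly (\<lambda>p. coeff p 0) (f * g) = map_poly (\<lambda>p. coeff p 0) f * map_poly (\<lambda>p. coeff p 0) g"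
    for f g :: bipoly
    by (intro poly_eqI; simp add: coeff_map_poly coeff_mult coeff_sum coeff_mult_0)+
  have "map_poly (\<lambda>p. coeff p 0) (subst1 [:[:a, 1:]:] p) = [:poly p a:]" for p
    by (induction p) (simp_all add: hom map_poly_pCons del: mult_pCons_left)
  then show ?thesis
    unfolding translate_def
    by (induction f) (simp_all add: hom map_poly_pCons pcompose_pCons del: mult_pCons_left)
qed

text \<open>Restricting to the line \<open>x = a\<close> keeps just the Taylor terms free of
  \<open>x - a\<close>, so those below the multiplicity still vanish.\<close>

lemma mult_at_le_order:
  assumes "map_poly (\<lambda>p. poly p a) f \<noteq> 0"
  shows "mult_at (a, c) f \<le> order c (map_poly (\<lambda>p. poly p a) f)"
proof -
  let ?r = "map_poly (\<lambda>p. poly p a) f" and ?m = "mult_at (a, c) f"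
  have "f \<noteq> 0" using assms by auto
  then have "vanish ?m (a, c) f"
    by (simp add: vanish_iff_mult_at)
  then have "coeff (?r \<circ>\<^sub>p [:c, 1:]) j = 0" if "j < ?m" for j
    using that unfolding pcompose_eval_x[symmetric] by (simp add: coeff_map_poly vanish_def)
  then have "monom 1 ?m dvd ?r \<circ>\<^sub>p [:c, 1:]"
    by (simp add: monom_1_dvd_iff')
  then obtain h where h: "?r \<circ>\<^sub>p [:c, 1:] = monom 1 ?m * h" by (elim dvdE)
  have pow: "(u ^ n) \<circ>\<^sub>p v = (u \<circ>\<^sub>p v) ^ n" for u v :: "complex poly" and n
    by (induction n) (simp_all add: pcompose_mult pcompose_1)
  have "?r \<circ>\<^sub>p [:c, 1:] \<circ>\<^sub>p [:- c, 1:] = [:- c, 1:] ^ ?m * (h \<circ>\<^sub>p [:- c, 1:])"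
    unfolding h by (simp add: pcompose_mult monom_altdef pow pcompose_pCons)
  moreover have "?r \<circ>\<^sub>p [:c, 1:] \<circ>\<^sub>p [:- c, 1:] = ?r"
    by (simp add: pcompose_assoc[symmetric] pcompose_pCons pcompose_idR)
  ultimately have "[:- c, 1:] ^ ?m dvd ?r" by (metis dvd_triv_left)
  then show ?thesis
    using assms by (simp add: order_divides)
qed

text \<open>The restriction of \<open>q\<close> to the line is non-zero: otherwise
  \<open>x - a\<close> would divide the irreducible \<open>q\<close>, which would then have degree 0
  in y. Its roots, counted with order, are bounded by its degree.\<close>

lemma sum_mult_at_vertical_line:
  fixes q :: bipoly
  assumes "irreducible q" "degree q > 0" "finite S"
  shows "(\<Sum>c\<in>S. mult_at (a, c) q) \<le> degree q"
proof -
  let ?r = "map_poly (\<lambda>p. poly p a) q"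
  have "?r \<noteq> 0"
  proof
    assume "?r = 0"
    then have "poly (coeff q j) a = 0" for j
      by (metis coeff_0 coeff_map_poly poly_0)
    then have "[:[:- a, 1:]:] dvd q"
      by (simp add: const_poly_dvd_iff poly_eq_0_iff_dvd)
    then obtain s where s: "q = [:[:- a, 1:]:] * s" by (elim dvdE)
    have "\<not> is_unit [:[:- a, 1:]:]"
      by (simp add: is_unit_const_poly_iff is_unit_iff_degree)
    then have "is_unit s" using s irreducibleD[OF assms(1) s] by blast
    then have "degree s = 0" by (simp add: is_unit_poly_iff) auto
    then have "degree q = 0" using s by (auto simp: degree_mult_eq)
    then show False using assms(2) by simp
  qed
  have "(\<Sum>c\<in>S. mult_at (a, c) q) \<le> (\<Sum>c\<in>S. order c ?r)"
    using mult_at_le_order[OF \<open>?r \<noteq> 0\<close>] by (intro sum_mono)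
  also have "\<dots> = (\<Sum>c\<in>S \<inter> {c. poly ?r c = 0}. order c ?r)"
    using assms(3) by (intro sum.mono_neutral_right) (auto simp: order_0I)
  also have "\<dots> \<le> (\<Sum>c | poly ?r c = 0. order c ?r)"
    using \<open>?r \<noteq> 0\<close> by (intro sum_mono2) (auto simp: poly_roots_finite)
  also have "\<dots> \<le> degree ?r"
    by (rule sum_order_le_degree) fact
  also have "\<dots> \<le> degree q"
    by (rule degree_le) (simp add: coeff_map_poly coeff_eq_0)
  finally show ?thesis .
qed

section \<open>Bezout's inequality and adjoint curves\<close>

lemma lincomb_bmonom_eq_0D:
  assumes "finite I" "(\<Sum>(i, j)\<in>I. [:[:c (i, j):]:] * bmonom i j) = 0" "x \<in> I"
  shows "c x = 0"
  using coeff_lincomb_bmonom[OF assms(1), of c "snd x" "fst x"] assms(2,3) by simp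

lemma sum_Plus:
  assumes "finite A" "finite B"
  shows "(\<Sum>x\<in>A <+> B. f x) = (\<Sum>x\<in>A. f (Inl x)) + (\<Sum>x\<in>B. f (Inr x))"
  using sum.Plus[OF assms, of f] by simp

text \<open>If the inequality fails, then \<open>f\<^sub>1 q + f\<^sub>2 q' + w = 0\<close> has a non-zero solution with \<open>w\<close> in
  the span of the interpolation basis for jets of order \<open>N = 2 \<mu> - 1\<close> and \<open>f\<^sub>1\<close>, \<open>f\<^sub>2\<close> vanishing to
  orders \<open>\<mu> - 1\<close> and \<open>\<mu>\<close>: unknowns minus equations is \<open>\<Sum> \<mu> (\<mu> - 1) - k (2 l - 1)\<close>, independently of
  the \<open>x\<close>-degree bound \<open>D\<close>. Then \<open>w\<close> vanishes to order \<open>N\<close>, so \<open>w = 0\<close>, and \<open>q\<close> divides \<open>f\<^sub>2\<close>,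
  whose \<open>y\<close>-degree is too small.\<close>

lemma bezout_pderiv:
  assumes irr: "irreducible q" and l: "degree q > 0" and "finite A"
  shows "(\<Sum>P\<in>A. mult_at P q * (mult_at P q - 1)) \<le> degree (swap q) * (2 * degree q - 1)"
proof (rule ccontr)
  define l where "l = degree q"
  define k where "k = degree (swap q)"
  define \<mu> where "\<mu> P = mult_at P q" for P
  assume "\<not> ?thesis"
  then have gt: "(\<Sum>P\<in>A. \<mu> P * (\<mu> P - 1)) > k * (2 * l - 1)"
    by (simp add: l_def k_def \<mu>_def)
  have "l > 0" using l by (simp add: l_def)
  \<comment> \<open>Points off the curve add nothing to the sum; on the curve the subtraction in
    \<open>2 * \<mu> P - 1\<close> is not truncated.\<close>
  define A' where "A' = {P \<in> A. \<mu> P > 0}"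
  define N where "N P = 2 * \<mu> P - 1" for P
  \<comment> \<open>Large enough that the combination, including \<open>w\<close>, has degree below
    \<open>D\<close> in x.\<close>
  define D where "D = k + 1 + (\<Sum>P\<in>A'. N P)"
  have [simp]: "finite A'" using \<open>finite A\<close> by (simp add: A'_def)
  have "q \<noteq> 0" using irr by auto
  \<comment> \<open>\<open>I1\<close>, \<open>I2\<close>, \<open>I3\<close> index the coefficients
    of \<open>f1\<close>, \<open>f2\<close>, \<open>w\<close>. The equations \<open>J1\<close> kill
    the coefficients of the combination, \<open>J2\<close> and \<open>J3\<close> prescribe the
    vanishing of \<open>f1\<close> and \<open>f2\<close>.\<close>
  define I1 where "I1 = {..<D - k} \<times> {..<l - 1}"
  define I2 where "I2 = {..<D - k} \<times> {..<l}"
  define I3 where "I3 = (SIGMA P:A'. triangle (N P))"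
  define J1 where "J1 = {..<D} \<times> {..<2 * l - 1}"
  define J2 where "J2 = (SIGMA P:A'. triangle (\<mu> P - 1))"
  define J3 where "J3 = (SIGMA P:A'. triangle (\<mu> P))"
  have fin [simp]: "finite I1" "finite I2" "finite I3" "finite J1" "finite J2" "finite J3"
    by (auto simp: I1_def I2_def I3_def J1_def J2_def J3_def intro!: finite_SigmaI)

  have bideg_q: "bideg k l q" "bideg k (l - 1) (pderiv q)"
  proof -
    show q: "bideg k l q" by (simp add: bideg_def k_def l_def)
    have "coeff (coeff (pderiv q) j) i = of_nat (Suc j) * coeff (coeff q (Suc j)) i" for i j
      unfolding coeff_pderiv of_nat_poly by simp
    then show "bideg k (l - 1) (pderiv q)"
      using q by (fastforce simp: bideg_iff simp del: of_nat_Suc)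
  qed

  define b3 where "b3 = (\<lambda>(P, i, j). [:[:- fst P, 1:]:] ^ i * [:[:- snd P:], 1:] ^ j * separator A' N P)"
  define M where "M = (\<lambda>x y. case y of
      Inl (r, s) \<Rightarrow> (case x of Inl (i, j) \<Rightarrow> coeff (coeff (bmonom i j * q) s) r
         | Inr (Inl (i, j)) \<Rightarrow> coeff (coeff (bmonom i j * pderiv q) s) r
         | Inr (Inr z) \<Rightarrow> coeff (coeff (b3 z) s) r)
    | Inr (Inl (P, r, s)) \<Rightarrow>
        (case x of Inl (i, j) \<Rightarrow> coeff (coeff (translate P (bmonom i j)) s) r | _ \<Rightarrow> 0)
    | Inr (Inr (P, r, s)) \<Rightarrow>
        (case x of Inr (Inl (i, j)) \<Rightarrow> coeff (coeff (translate P (bmonom i j)) s) r | _ \<Rightarrow> 0))"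

  have "card (J1 <+> (J2 <+> J3)) < card (I1 <+> (I2 <+> I3))"
  proof -
    \<comment> \<open>At each point the unknowns of the jet exceed the vanishing conditions by
      \<open>\<mu> P * (\<mu> P - 1)\<close>.\<close>
    have tri: "card (triangle (N P)) = card (triangle (\<mu> P - 1)) + card (triangle (\<mu> P)) + \<mu> P * (\<mu> P - 1)"
      if P: "P \<in> A'" for P
    proof -
      obtain n where n: "\<mu> P = Suc n"
        using P by (auto simp: A'_def gr0_conv_Suc)
      show ?thesis
        using card_triangle[of "N P"] card_triangle[of "\<mu> P"] card_triangle[of "\<mu> P - 1"]
        unfolding N_def n by (simp add: algebra_simps)
    qed
    have "(\<Sum>P\<in>A'. \<mu> P * (\<mu> P - 1)) = (\<Sum>P\<in>A. \<mu> P * (\<mu> P - 1))"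
      using \<open>finite A\<close> by (intro sum.mono_neutral_left) (auto simp: A'_def)
    then have "card I3 > card J2 + card J3 + k * (2 * l - 1)"
      using gt by (simp add: I3_def J2_def J3_def card_SigmaI tri sum.distrib)
    moreover have "card I1 + card I2 + k * (2 * l - 1) = card J1"
    proof -
      obtain n where n: "l = Suc n" using \<open>l > 0\<close> by (auto simp: gr0_conv_Suc)
      obtain d where d: "D = k + d" by (auto simp: D_def)
      show ?thesis
        by (simp add: I1_def I2_def J1_def n d algebra_simps)
    qed
    ultimately show ?thesis by (simp add: card_Plus)
  qed
  then obtain c where c: "\<exists>x\<in>I1 <+> (I2 <+> I3). c x \<noteq> 0"
    "\<And>y. y \<in> J1 <+> (J2 <+> J3) \<Longrightarrow> (\<Sum>x\<in>I1 <+> (I2 <+> I3). c x * M x y) = 0"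
    using underdetermined_system[of "J1 <+> (J2 <+> J3)" "I1 <+> (I2 <+> I3)" M] by auto

  define f1 where "f1 = (\<Sum>(i, j)\<in>I1. [:[:c (Inl (i, j)):]:] * bmonom i j)"
  define f2 where "f2 = (\<Sum>(i, j)\<in>I2. [:[:c (Inr (Inl (i, j))):]:] * bmonom i j)"
  define w where "w = (\<Sum>(P, i, j)\<in>I3. [:[:c (Inr (Inr (P, i, j))):]:]
      * ([:[:- fst P, 1:]:] ^ i * [:[:- snd P:], 1:] ^ j * separator A' N P))"
  have f1': "f1 = (\<Sum>x\<in>I1. [:[:c (Inl x):]:] * (case x of (i, j) \<Rightarrow> bmonom i j))"
    and f2': "f2 = (\<Sum>x\<in>I2. [:[:c (Inr (Inl x)):]:] * (case x of (i, j) \<Rightarrow> bmonom i j))"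
    and w': "w = (\<Sum>x\<in>I3. [:[:c (Inr (Inr x)):]:] * b3 x)"
    unfolding f1_def f2_def w_def b3_def by (intro sum.cong; auto)+

  have van1: "vanish (\<mu> P - 1) P f1" if P: "P \<in> A'" for P
    unfolding vanish_def
  proof (intro allI impI)
    fix r s assume "r + s < \<mu> P - 1"
    then have "Inr (Inl (P, r, s)) \<in> J1 <+> (J2 <+> J3)"
      using P by (auto simp: J2_def triangle_def)
    from c(2)[OF this] show "coeff (coeff (translate P f1) s) r = 0"
      unfolding f1' coeff_translate_lincomb by (simp add: sum_Plus M_def case_prod_beta)
  qed
  have van2: "vanish (\<mu> P) P f2" if P: "P \<in> A'" for P
    unfolding vanish_def
  proof (intro allI impI)
    fix r s assume "r + s < \<mu> P"
    then have "Inr (Inr (P, r, s)) \<in> J1 <+> (J2 <+> J3)"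
      using P by (auto simp: J3_def triangle_def)
    from c(2)[OF this] show "coeff (coeff (translate P f2) s) r = 0"
      unfolding f2' coeff_translate_lincomb by (simp add: sum_Plus M_def case_prod_beta)
  qed

  have deg: "bideg (D - 1) (2 * l - 2) (f1 * q + f2 * pderiv q + w)"
  proof (intro bideg_add)
    show "bideg (D - 1) (2 * l - 2) (f1 * q)"
    \<comment> \<open>For \<open>l = 1\<close> the bound \<open>l - 2\<close> would be truncated,
      but then \<open>I1\<close> is empty and \<open>f1 = 0\<close>.\<close>
    proof (cases "l = 1")
      case False
      have "bideg (D - k - 1) (l - 2) f1"
        unfolding f1_def I1_def
        by (intro bideg_sum) (auto simp del: mult_pCons_left intro!: bideg_bconst_mult bideg_bmonom)
      from bideg_mult[OF this bideg_q(1)] show ?thesis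
        using False \<open>l > 0\<close> by (auto elim!: bideg_mono simp: D_def)
    qed (simp add: f1_def I1_def)
    have "bideg (D - k - 1) (l - 1) f2"
      unfolding f2_def I2_def
      by (intro bideg_sum) (auto simp del: mult_pCons_left intro!: bideg_bconst_mult bideg_bmonom)
    from bideg_mult[OF this bideg_q(2)] show "bideg (D - 1) (2 * l - 2) (f2 * pderiv q)"
      using \<open>l > 0\<close> by (auto elim!: bideg_mono simp: D_def)
    have "bideg (D - 1) (2 * l - 2) ([:[:- fst P, 1:]:] ^ i * [:[:- snd P:], 1:] ^ j * separator A' N P)"
      if P: "P \<in> A'" and ij: "i + j < N P" for P i j
    proof -
      let ?H = "{R \<in> A'. fst R \<noteq> fst P}" and ?V = "{R \<in> A'. fst R = fst P \<and> R \<noteq> P}"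
      have "bideg (i * Suc 0 + j * 0 + sum N ?H) (i * 0 + j * Suc 0 + sum N ?V)
          ([:[:- fst P, 1:]:] ^ i * [:[:- snd P:], 1:] ^ j * separator A' N P)"
        by (intro bideg_mult bideg_power bideg_lin_x bideg_lin_y bideg_separator)
      moreover have "sum N ?H + N P \<le> sum N A'"
      proof -
        have "sum N ?H + N P = sum N (insert P ?H)" by simp
        also have "\<dots> \<le> sum N A'" using P by (intro sum_mono2) auto
        finally show ?thesis .
      qed
      \<comment> \<open>Along the vertical line through \<open>P\<close> the orders
        \<open>2 * \<mu> R - 1\<close> sum to twice the total multiplicity, at most
        \<open>2 * l\<close>, minus the number of points, which is at least one.\<close>
      moreover have "sum N ?V + N P \<le> 2 * l - 1"
      proof -
        let ?L = "{R \<in> A'. fst R = fst P}"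
        have "sum N ?V + N P = sum N (insert P ?V)" by simp
        also have "insert P ?V = ?L" using P by auto
        finally have eq: "sum N ?V + N P = sum N ?L" .
        have "(\<Sum>R\<in>?L. N R + 1) = (\<Sum>R\<in>?L. 2 * \<mu> R)"
          by (intro sum.cong) (auto simp: N_def A'_def)
        then have "sum N ?L + card ?L = 2 * (\<Sum>R\<in>?L. \<mu> R)"
          by (simp only: sum.distrib sum_distrib_left card_eq_sum)
        moreover have "card ?L > 0"
        proof -
          have "P \<in> ?L" using P by simp
          moreover have "finite ?L" by simp
          ultimately show ?thesis unfolding card_gt_0_iff by blast
        qed
        moreover have "(\<Sum>R\<in>?L. \<mu> R) \<le> l"
        proof -
          have "(\<Sum>R\<in>?L. \<mu> R) = (\<Sum>c\<in>snd ` ?L. mult_at (fst P, c) q)"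
            by (subst sum.reindex) (auto simp: inj_on_def \<mu>_def prod_eq_iff intro!: sum.cong)
          also have "\<dots> \<le> l"
            unfolding l_def using irr l by (intro sum_mult_at_vertical_line) auto
          finally show ?thesis .
        qed
        ultimately show ?thesis unfolding eq by linarith
      qed
      ultimately show ?thesis
        using ij by (elim bideg_mono) (auto simp: D_def)
    qed
    then show "bideg (D - 1) (2 * l - 2) w"
      unfolding w_def I3_def
      by (intro bideg_sum) (auto simp del: mult_pCons_left simp: triangle_def intro!: bideg_bconst_mult)
  qed
  have low: "coeff (coeff (f1 * q + f2 * pderiv q + w) s) r = 0" if "r < D" "s < 2 * l - 1" for r s
  proof -
    have "Inl (r, s) \<in> J1 <+> (J2 <+> J3)"
      using that by (auto simp: J1_def)
    from c(2)[OF this] show ?thesis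
      unfolding f1' f2' w'
      by (simp add: sum_Plus M_def case_prod_unfold sum_distrib_right coeff_sum mult.assoc add.assoc)
  qed
  \<comment> \<open>\<open>J1\<close> covers the whole box of bi-degrees allowed by
    \<open>deg\<close>.\<close>
  have eq0: "f1 * q + f2 * pderiv q + w = 0"
  proof (intro poly_eqI)
    fix s r
    show "coeff (coeff (f1 * q + f2 * pderiv q + w) s) r = coeff (coeff 0 s) r"
    proof (cases "r < D \<and> s < 2 * l - 1")
      case False
      moreover have "D > 0" by (simp add: D_def)
      ultimately have "\<not> (r \<le> D - 1 \<and> s \<le> 2 * l - 2)"
        using \<open>l > 0\<close> by linarith
      with deg show ?thesis unfolding bideg_iff by auto
    qed (simp add: low del: coeff_add)
  qed

  have w_van: "vanish (N P) P w" if P: "P \<in> A'" for P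
  proof -
    have q: "vanish (\<mu> P) P q"
      using \<open>q \<noteq> 0\<close> by (simp add: vanish_iff_mult_at \<mu>_def)
    have "w = - (f1 * q + f2 * pderiv q)"
      using eq0 by (metis add.inverse_unique add.commute minus_unique)
    moreover have "vanish (\<mu> P - 1 + \<mu> P) P (f1 * q)"
      using van1[OF P] q by (rule vanish_mult)
    moreover have "vanish (\<mu> P + (\<mu> P - 1)) P (f2 * pderiv q)"
      using van2[OF P] vanish_pderiv[OF q] by (rule vanish_mult)
    moreover have "\<mu> P - 1 + \<mu> P = N P" "\<mu> P + (\<mu> P - 1) = N P"
      using P by (auto simp: N_def A'_def)
    ultimately show ?thesis
      by (metis vanish_add vanish_minus)
  qed
  have c3: "c (Inr (Inr x)) = 0" if "x \<in> I3" for x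
    using separators_independent[of A' w "\<lambda>z. c (Inr (Inr z))" N "fst x" "fst (snd x)" "snd (snd x)"]
      w_van that unfolding w_def I3_def by auto
  then have "w = 0" by (simp add: w')
  with eq0 have eq: "f1 * q = - (f2 * pderiv q)"
    by (simp add: eq_neg_iff_add_eq_0)
  \<comment> \<open>The derivative is non-zero and of smaller degree in y, so the prime
    \<open>q\<close> can only divide \<open>f2\<close>, whose degree in y is also too small.\<close>
  have "prime_elem q" using irr by (rule irreducible_imp_prime_elem)
  moreover have "q dvd f2 * pderiv q"
    using eq by (metis dvd_minus_iff dvd_triv_right)
  ultimately have "q dvd f2 \<or> q dvd pderiv q"
    by (rule prime_elem_dvd_multD)
  moreover have "\<not> q dvd pderiv q"
    proof
    assume "q dvd pderiv q"
    moreover have "pderiv q \<noteq> 0" using l by (simp add: pderiv_eq_0_iff)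
    ultimately have "degree q \<le> degree (pderiv q)" by (rule dvd_imp_degree_le)
    then show False using l by (simp add: degree_pderiv)
  qed
  ultimately have "q dvd f2" by blast
  moreover have "degree f2 < degree q"
  proof -
    have "bideg D (l - 1) f2"
      unfolding f2_def I2_def
      by (intro bideg_sum) (auto simp del: mult_pCons_left intro!: bideg_bconst_mult bideg_bmonom)
    then show ?thesis using l unfolding bideg_def l_def by linarith
  qed
  ultimately have "f2 = 0"
    using dvd_imp_degree_le by (metis not_le)
  then have "f1 = 0" using eq \<open>q \<noteq> 0\<close> by simp
  have "c (Inl x) = 0" if "x \<in> I1" for x
    using lincomb_bmonom_eq_0D[of I1 "\<lambda>x. c (Inl x)" x] \<open>f1 = 0\<close> that unfolding f1_def by simp
  moreover have "c (Inr (Inl x)) = 0" if "x \<in> I2" for x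
    using lincomb_bmonom_eq_0D[of I2 "\<lambda>x. c (Inr (Inl x))" x] \<open>f2 = 0\<close> that unfolding f2_def by simp
  ultimately show False
    using c(1) c3 by auto
qed

text \<open>In classical terms \<open>G\<close> is an adjoint curve of \<open>q\<close>. Positivity
  of both degrees makes the final comparison strict.\<close>

lemma exists_adjoint:
  assumes "irreducible q" "degree q > 0" "degree (swap q) > 0" "finite A"
  shows "\<exists>G. G \<noteq> 0 \<and> bideg (degree (swap q) - 1) (degree q - 1) G
    \<and> (\<forall>P\<in>A. vanish (mult_at P q - 1) P G)"
proof (rule exists_vanishing)
  let ?k = "degree (swap q)" and ?l = "degree q"
  have "2 * card (triangle (n - 1)) = n * (n - 1)" for n
    using card_triangle[of "n - 1"] by (cases n) auto
  then have "2 * (\<Sum>P\<in>A. card (triangle (mult_at P q - 1))) = (\<Sum>P\<in>A. mult_at P q * (mult_at P q - 1))"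
    by (simp add: sum_distrib_left)
  also have "\<dots> \<le> ?k * (2 * ?l - 1)"
    using assms by (intro bezout_pderiv)
  also have "\<dots> < 2 * (?k * ?l)"
    using assms by (subst mult.left_commute, intro mult_strict_left_mono) auto
  finally show "(\<Sum>P\<in>A. card (triangle (mult_at P q - 1))) < ?k * ?l" by simp
qed fact

section \<open>The affine grid\<close>

lemma translate_x_poly: "translate (a, c) [:V:] = translate (a, c') [:V:]"
  by (simp add: translate_def)

lemma translate_y_poly: "translate (a, c) (swap [:H:]) = translate (a', c) (swap [:H:])"
  by (induction H) (simp_all add: translate_def swap_def subst2_hom)

lemma mult_at_x_poly: "mult_at (a, c) [:V:] = mult_at (a, c') [:V:]"
  unfolding mult_at_def using translate_x_poly by metis

lemma mult_at_y_poly: "mult_at (a, c) (swap [:H:]) = mult_at (a', c) (swap [:H:])"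
  unfolding mult_at_def using translate_y_poly by metis

lemma mult_at_gt_0D:
  assumes "mult_at P f > 0"
  shows "coeff (coeff (translate P f) 0) 0 = 0"
proof (cases "f = 0")
  case False
  then have "vanish 1 P f" using assms by (simp add: vanish_iff_mult_at)
  then show ?thesis by (simp add: vanish_def)
qed (simp add: translate_def)

lemma root_if_mult_at_x_poly: "mult_at (a, c) [:V:] > 0 \<Longrightarrow> poly V a = 0"
proof -
  have "coeff (coeff (subst1 [:[:a, 1:]:] V) 0) 0 = poly V a"
    by (induction V) (simp_all add: coeff_mult_0)
  then show "mult_at (a, c) [:V:] > 0 \<Longrightarrow> poly V a = 0"
    by (auto dest!: mult_at_gt_0D simp: translate_def)
qed

lemma root_if_mult_at_y_poly: "mult_at (a, c) (swap [:H:]) > 0 \<Longrightarrow> poly H c = 0"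
proof -
  have "coeff (coeff (translate (a, c) (swap [:H:])) 0) 0 = poly H c"
    by (induction H) (simp_all add: translate_def swap_def subst2_hom coeff_mult_0)
  then show "mult_at (a, c) (swap [:H:]) > 0 \<Longrightarrow> poly H c = 0"
    by (auto dest!: mult_at_gt_0D)
qed

text \<open>Induction over the prime factors: those constant in y, and the unit, go into
  \<open>V\<close>, those constant in x into \<open>H\<close>.\<close>

lemma split_if_no_mixed_prime_factor:
  fixes f :: bipoly
  assumes "f \<noteq> 0" "\<And>p. prime p \<Longrightarrow> p dvd f \<Longrightarrow> degree p = 0 \<or> degree (swap p) = 0"
  shows "\<exists>V H. f = [:V:] * swap [:H:]"
  using assms
proof (induction f rule: prime_divisors_induct)
  case (unit f)
  then obtain c where "f = [:c:]" by (auto simp: is_unit_poly_iff)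
  then have "f = [:c:] * swap [:1:]" by (simp add: swap_def)
  then show ?case by blast
next
  case (factor p f)
  then obtain V H where VH: "f = [:V:] * swap [:H:]"
    by (metis dvd_mult mult_zero_right)
  have "degree p = 0 \<or> degree (swap p) = 0"
    using factor by simp
  then show ?case
  proof
    assume "degree p = 0"
    then obtain q where "p = [:q:]" by (metis degree_eq_zeroE)
    then have "p * f = [:q * V:] * swap [:H:]" by (simp add: VH mult.commute)
    then show ?thesis by blast
  next
    assume "degree (swap p) = 0"
    then obtain q where "swap p = [:q:]" by (metis degree_eq_zeroE)
    then have "p = swap [:q:]" by (metis swap_swap)
    then have "p * f = [:V:] * swap ([:q:] * [:H:])" unfolding VH swap_mult by (simp only: mult_ac)
    then have "p * f = [:V:] * swap [:q * H:]" by (simp add: mult.commute)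
    then show ?thesis by blast
  qed
qed simp

text \<open>The assumption \<open>min\<close> is what the equality of the two values of
  \<open>alpha_star\<close> becomes in the chart; its guard \<open>k > 0\<close> excludes a
  truncated \<open>k - 1\<close>.\<close>

lemma affine_grid:
  fixes f :: bipoly
  assumes "finite A" "A \<noteq> {}" and f: "f \<noteq> 0" "bideg k k f" "\<And>P. P \<in> A \<Longrightarrow> vanish (m + 1) P f"
    and min: "\<And>g. \<lbrakk>k > 0; bideg (k - 1) (k - 1) g; \<And>P. P \<in> A \<Longrightarrow> vanish m P g\<rbrakk> \<Longrightarrow> g = 0"
  shows "\<exists>V H. A = V \<times> H"
proof -
  have mult_f: "m + 1 \<le> mult_at P f" if "P \<in> A" for P
    using f(3)[OF that] f(1) by (simp add: vanish_iff_mult_at)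
  \<comment> \<open>A non-zero constant does not vanish at a point of the non-empty
    \<open>A\<close>.\<close>
  have "k > 0"
  proof (rule ccontr)
    assume "\<not> k > 0"
    then have "f = [:[:coeff (coeff f 0) 0:]:]"
      using bipoly_expand[OF f(2)] by simp
    then obtain c where c: "f = [:[:c:]:]" by blast
    obtain P where "P \<in> A" using \<open>A \<noteq> {}\<close> by blast
    then have "mult_at P f > 0" using mult_f by fastforce
    then have "c = 0" using mult_at_gt_0D[of P f] by (simp add: c translate_def)
    then show False using f(1) c by simp
  qed
  have no_mixed: "degree q = 0 \<or> degree (swap q) = 0" if q: "prime q" "q dvd f" for q
  proof (rule ccontr)
    assume "\<not> ?thesis"
    then have pos: "degree q > 0" "degree (swap q) > 0" by auto
    obtain r where r: "f = q * r" using q(2) by (elim dvdE)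
    have nz: "q \<noteq> 0" "r \<noteq> 0" using f(1) r by auto
    have "irreducible q" using q(1) by (simp add: prime_elem_imp_irreducible)
    from exists_adjoint[OF this pos \<open>finite A\<close>] obtain G where
      G: "G \<noteq> 0" "bideg (degree (swap q) - 1) (degree q - 1) G"
        "\<And>P. P \<in> A \<Longrightarrow> vanish (mult_at P q - 1) P G" by blast
    have "bideg (k - degree (swap q)) (k - degree q) r"
      using bideg_mult_D f(1,2) r by metis
    from bideg_mult[OF this G(2)] have "bideg (k - 1) (k - 1) (r * G)"
    proof (rule bideg_mono)
      have "degree (swap q) \<le> degree (swap f)" "degree q \<le> degree f"
        using r nz by (simp_all add: swap_mult degree_mult_eq)
      then have "degree (swap q) \<le> k" "degree q \<le> k"
        using f(2) by (auto simp: bideg_def)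
      then show "k - degree (swap q) + (degree (swap q) - 1) \<le> k - 1"
        "k - degree q + (degree q - 1) \<le> k - 1" using pos by linarith+
    qed
    moreover have "vanish m P (r * G)" if "P \<in> A" for P
    proof -
      have "mult_at P f = mult_at P q + mult_at P r"
        using r f(1) by (simp add: mult_at_mult)
      moreover have "mult_at P q - 1 \<le> mult_at P G"
        using G(1) G(3)[OF that] by (simp add: vanish_iff_mult_at)
      ultimately show ?thesis
        using mult_f[OF that] nz G(1) by (simp add: vanish_iff_mult_at mult_at_mult)
    qed
    ultimately have "r * G = 0"
      by (rule min[OF \<open>k > 0\<close>])
    then show False using nz G(1) by simp
  qed
  then obtain V H where VH: "f = [:V:] * swap [:H:]"
    using split_if_no_mixed_prime_factor[OF f(1)] by blast
  have nz: "V \<noteq> 0" "H \<noteq> 0" using f(1) VH by (auto simp: swap_def)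
  have split: "mult_at P f = mult_at P [:V:] + mult_at P (swap [:H:])" for P
    using f(1) unfolding VH by (rule mult_at_mult)
  have sw: "degree (swap [:V:]) = degree V" for V :: "complex poly"
  proof -
    have "swap [:V:] = map_poly (\<lambda>c. [:c:]) V" by (simp add: swap_def subst1_yy)
    then show ?thesis by (simp add: degree_map_poly)
  qed
  have degV: "degree V \<le> k" and degH: "degree H \<le> k"
  proof -
    have "swap f = swap [:V:] * [:H:]" unfolding VH swap_mult by simp
    moreover have "swap [:V:] \<noteq> 0" "[:H:] \<noteq> 0" "[:V:] \<noteq> 0" "swap [:H:] \<noteq> 0" using nz by simp_all
    ultimately have "degree (swap f) = degree V" "degree f = degree H"
      using degree_mult_eq[of "swap [:V:]" "[:H:]"] degree_mult_eq[of "[:V:]" "swap [:H:]"] sw VH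
      by (simp_all del: mult_pCons_left mult_pCons_right)
    then show "degree V \<le> k" "degree H \<le> k" using f(2) by (auto simp: bideg_def)
  qed

  \<comment> \<open>No factor \<open>V1(x) H1(y)\<close> can be split off if both degrees drop below
    \<open>k\<close> and every point keeps order \<open>m\<close>: the quotient would violate
    \<open>min\<close>.\<close>
  have removal: False
    if V: "V = V1 * V2" and H: "H = H1 * H2" and deg: "degree V2 \<le> k - 1" "degree H2 \<le> k - 1"
      and mult: "\<And>P. P \<in> A \<Longrightarrow> m + mult_at P [:V1:] + mult_at P (swap [:H1:]) \<le> mult_at P f"
    for V1 V2 H1 H2
  proof -
    let ?u = "[:V1:] * swap [:H1:]" and ?g = "[:V2:] * swap [:H2:]"
    have nz: "[:V1:] * swap [:H1:] \<noteq> 0" "?g \<noteq> 0"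
      using nz V H unfolding mult_eq_0_iff by auto
    have "[:H:] = [:H1:] * [:H2:]" "[:V:] = [:V1:] * [:V2:]" by (simp_all add: H V)
    then have fug: "f = ?u * ?g" unfolding VH by (simp only: swap_mult mult_ac)
    have "bideg (k - 1) 0 [:V2:]" "bideg 0 (k - 1) (swap [:H2:])"
      using deg by (simp_all add: bideg_def sw del: swap_swap) (simp_all add: deg)
    from bideg_mult[OF this] have "bideg (k - 1) (k - 1) ?g" by simp
    moreover have "vanish m P ?g" if "P \<in> A" for P
    proof -
      have "mult_at P f = mult_at P [:V1:] + mult_at P (swap [:H1:]) + mult_at P ?g"
        using f(1) nz fug mult_at_mult by metis
      then show ?thesis using mult[OF that] unfolding vanish_iff_mult_at[OF nz(2)] by linarith
    qed
    ultimately show False using min[OF \<open>k > 0\<close>] nz by blast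
  qed

  have lin: "mult_at P [:[:- a, 1:]:] = (if fst P = a then 1 else 0)"
    "mult_at P (swap [:[:- c, 1:]:]) = (if snd P = c then 1 else 0)" for P a c
  proof -
    have "swap [:[:- c, 1:]:] = [:[:- c:], 1:]" by (simp add: swap_def)
    then show "mult_at P (swap [:[:- c, 1:]:]) = (if snd P = c then 1 else 0)"
      by (simp only: mult_at_lin_y)
  qed (rule mult_at_lin_x)
  have one: "swap [:1:] = 1" "[:1:] = (1 :: bipoly)" "swap 1 = 1" by (simp_all add: swap_def one_pCons)
  have deg_less: "degree q \<le> k - 1" if "p = [:- a, 1:] * q" "p \<noteq> 0" "degree p \<le> k" for p q :: "complex poly" and a
  proof -
    have "q \<noteq> 0" using that by auto
    then have "degree p = degree [:- a, 1:] + degree q"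
      unfolding that(1) by (intro degree_mult_eq) auto
    then show ?thesis using that(3) by simp
  qed

  have multV: "mult_at (a, c) [:V:] > 0" if "poly V a = 0" for a c
  proof -
    obtain V' where "V = [:- a, 1:] * V'" using \<open>poly V a = 0\<close> unfolding poly_eq_0_iff_dvd dvd_def by blast
    then have eq: "[:V:] = [:[:- a, 1:]:] * [:V':]" by simp
    then have "[:[:- a, 1:]:] * [:V':] \<noteq> 0" using nz by (metis pCons_eq_0_iff)
    then show ?thesis unfolding eq by (subst mult_at_mult) (simp_all only: lin, simp_all)
  qed
  have multH: "mult_at (a, c) (swap [:H:]) > 0" if "poly H c = 0" for a c
  proof -
    obtain H' where "H = [:- c, 1:] * H'" using \<open>poly H c = 0\<close> unfolding poly_eq_0_iff_dvd dvd_def by blast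
    then have "[:H:] = [:[:- c, 1:]:] * [:H':]" by simp
    then have eq: "swap [:H:] = swap [:[:- c, 1:]:] * swap [:H':]" by (simp only: swap_mult)
    then have "swap [:[:- c, 1:]:] * swap [:H':] \<noteq> 0" using nz by (metis pCons_eq_0_iff swap_eq_0_iff)
    then show ?thesis unfolding eq by (subst mult_at_mult) (simp_all only: lin, simp_all)
  qed

  \<comment> \<open>Splitting off \<open>(x - a) (y - c)\<close> costs two orders only at
    \<open>(a, c)\<close> and at most one elsewhere, so it is harmless unless \<open>(a, c)\<close>
    is in \<open>A\<close> with order exactly \<open>m + 1\<close>.\<close>
  have removal2: "(a, c) \<in> A \<and> mult_at (a, c) f < m + 2" if "poly V a = 0" "poly H c = 0" for a c
  proof (rule ccontr)
    assume "\<not> ?thesis"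
    then have big: "(a, c) \<in> A \<Longrightarrow> m + 2 \<le> mult_at (a, c) f" by auto
    obtain V' where V': "V = [:- a, 1:] * V'" using \<open>poly V a = 0\<close> unfolding poly_eq_0_iff_dvd dvd_def by blast
    obtain H' where H': "H = [:- c, 1:] * H'" using \<open>poly H c = 0\<close> unfolding poly_eq_0_iff_dvd dvd_def by blast
    have "m + mult_at P [:[:- a, 1:]:] + mult_at P (swap [:[:- c, 1:]:]) \<le> mult_at P f" if "P \<in> A" for P
      using mult_f[OF that] big that unfolding lin by (cases P) auto
    then show False
      using removal[OF V' H' deg_less[OF V' nz(1) degV] deg_less[OF H' nz(2) degH]] by blast
  qed
  have root: "\<exists>c. poly p c = 0" if "degree p > 0" for p :: "complex poly"
    using that fundamental_theorem_of_algebra[of p] by (auto simp: constant_degree)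

  \<comment> \<open>Otherwise \<open>H\<close> alone supplies the order \<open>m + 1\<close> on the
    whole line \<open>y = c\<close>. If \<open>V\<close> is constant, \<open>y - c\<close> can be
    split off by itself; if \<open>V\<close> has a root \<open>a'\<close>, the order at
    \<open>(a', c)\<close> is at least \<open>m + 2\<close>, against
    \<open>removal2\<close>.\<close>
  have "poly V a = 0" if "(a, c) \<in> A" for a c
  proof (rule ccontr)
    assume no: "poly V a \<noteq> 0"
    then have 0: "mult_at (a, c') [:V:] = 0" for c'
      using root_if_mult_at_x_poly by blast
    then have Hc: "m + 1 \<le> mult_at (a, c) (swap [:H:])"
      using mult_f[OF that] split by simp
    then have "poly H c = 0"
      by (intro root_if_mult_at_y_poly[of a]) linarith
    show False
    proof (cases "degree V = 0")
      case True
      obtain H' where H': "H = [:- c, 1:] * H'" using \<open>poly H c = 0\<close> unfolding poly_eq_0_iff_dvd dvd_def by blast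
      have V: "V = 1 * V" and degV: "degree V \<le> k - 1" using True by simp_all
      have "m + mult_at P [:1:] + mult_at P (swap [:[:- c, 1:]:]) \<le> mult_at P f" if "P \<in> A" for P
        using mult_f[OF that] unfolding lin one by auto
      then show False
        using removal[OF V H' degV deg_less[OF H' nz(2) degH]] by blast
    next
      case False
      then obtain a' where a': "poly V a' = 0" using root by blast
      have "m + 1 \<le> mult_at (a', c) (swap [:H:])"
        using Hc mult_at_y_poly by metis
      then have "m + 2 \<le> mult_at (a', c) f"
        using multV[OF a', of c] split[of "(a', c)"] by linarith
      then show False using removal2[OF a' \<open>poly H c = 0\<close>] by simp
    qed
  qed
  \<comment> \<open>The same argument with the two factors exchanged.\<close>
  moreover have "poly H c = 0" if "(a, c) \<in> A" for a c
  proof (rule ccontr)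
    assume no: "poly H c \<noteq> 0"
    then have 0: "mult_at (a', c) (swap [:H:]) = 0" for a'
      using root_if_mult_at_y_poly by blast
    then have Va: "m + 1 \<le> mult_at (a, c) [:V:]"
      using mult_f[OF that] split by simp
    then have "poly V a = 0"
      by (intro root_if_mult_at_x_poly[of a c]) linarith
    show False
    proof (cases "degree H = 0")
      case True
      obtain V' where V': "V = [:- a, 1:] * V'" using \<open>poly V a = 0\<close> unfolding poly_eq_0_iff_dvd dvd_def by blast
      have H: "H = 1 * H" and degH: "degree H \<le> k - 1" using True by simp_all
      have "m + mult_at P [:[:- a, 1:]:] + mult_at P (swap [:1:]) \<le> mult_at P f" if "P \<in> A" for P
        using mult_f[OF that] unfolding lin one by auto
      then show False
        using removal[OF V' H deg_less[OF V' nz(1) degV] degH] by blast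
    next
      case False
      then obtain c' where c': "poly H c' = 0" using root by blast
      have "m + 1 \<le> mult_at (a, c') [:V:]"
        using Va mult_at_x_poly by metis
      then have "m + 2 \<le> mult_at (a, c') f"
        using multH[OF c', of a] split[of "(a, c')"] by linarith
      then show False using removal2[OF \<open>poly V a = 0\<close> c'] by simp
    qed
  qed
  ultimately have "A = {a. poly V a = 0} \<times> {c. poly H c = 0}"
    using removal2 by fast
  then show ?thesis by blast
qed

section \<open>Forms and dehomogenization\<close>

definition monom_value :: "(var \<Rightarrow> 'b::comm_ring_1) \<Rightarrow> monom \<Rightarrow> 'b" where
  "monom_value v e = v X0 ^ Poly_Mapping.lookup e X0 * v X1 ^ Poly_Mapping.lookup e X1 * v Y0 ^ Poly_Mapping.lookup e Y0 * v Y1 ^ Poly_Mapping.lookup e Y1"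

lemma monom_value_add: "monom_value v (e + e') = monom_value v e * monom_value v e'"
  by (simp add: monom_value_def lookup_add power_add mult_ac)

lemma poly_mapping_sum_single: "F = (\<Sum>e\<in>Poly_Mapping.keys F. Poly_Mapping.single e (Poly_Mapping.lookup F e))"
proof (rule poly_mapping_eqI)
  fix e
  have "(\<Sum>e'\<in>Poly_Mapping.keys F. Poly_Mapping.lookup (Poly_Mapping.single e' (Poly_Mapping.lookup F e')) e)
      = (\<Sum>e'\<in>Poly_Mapping.keys F. if e' = e then Poly_Mapping.lookup F e' else 0)"
    by (intro sum.cong) (auto simp: lookup_single when_def)
  also have "\<dots> = Poly_Mapping.lookup F e"
    by (auto simp: in_keys_iff)
  finally show "Poly_Mapping.lookup F e = Poly_Mapping.lookup (\<Sum>e\<in>Poly_Mapping.keys F. Poly_Mapping.single e (Poly_Mapping.lookup F e)) e"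
    by (simp add: lookup_sum)
qed

text \<open>One evaluation homomorphism for two targets: forms, for linear substitutions, and
  bivariate polynomials, for dehomogenization.\<close>

locale coeff_hom =
  fixes \<kappa> :: "complex \<Rightarrow> 'b::comm_ring_1"
  assumes \<kappa>_0: "\<kappa> 0 = 0" and \<kappa>_1: "\<kappa> 1 = 1"
    and \<kappa>_add: "\<kappa> (c + d) = \<kappa> c + \<kappa> d" and \<kappa>_mult: "\<kappa> (c * d) = \<kappa> c * \<kappa> d"
begin

definition eval :: "(var \<Rightarrow> 'b) \<Rightarrow> form_ring \<Rightarrow> 'b" where
  "eval v F = (\<Sum>e\<in>Poly_Mapping.keys F. \<kappa> (Poly_Mapping.lookup F e) * monom_value v e)"

lemma eval_superset:
  assumes "finite S" "Poly_Mapping.keys F \<subseteq> S"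
  shows "eval v F = (\<Sum>e\<in>S. \<kappa> (Poly_Mapping.lookup F e) * monom_value v e)"
  unfolding eval_def using assms
  by (intro sum.mono_neutral_left) (auto simp: in_keys_iff \<kappa>_0)

lemma eval_0 [simp]: "eval v 0 = 0"
  by (simp add: eval_def)

lemma eval_add: "eval v (F + G) = eval v F + eval v G"
proof -
  let ?S = "Poly_Mapping.keys F \<union> Poly_Mapping.keys G"
  have "eval v H = (\<Sum>e\<in>?S. \<kappa> (Poly_Mapping.lookup H e) * monom_value v e)" if "Poly_Mapping.keys H \<subseteq> ?S" for H
    using that by (intro eval_superset) auto
  then show ?thesis
    using keys_add[of F G] by (simp add: lookup_add \<kappa>_add algebra_simps sum.distrib)
qed

lemma eval_sum: "eval v (\<Sum>i\<in>I. F i) = (\<Sum>i\<in>I. eval v (F i))"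
  by (induction I rule: infinite_finite_induct) (simp_all add: eval_add)

lemma eval_single: "eval v (Poly_Mapping.single e c) = \<kappa> c * monom_value v e"
  by (simp add: eval_def \<kappa>_0)

lemma eval_mult: "eval v (F * G) = eval v F * eval v G"
proof -
  have "F * G = (\<Sum>e\<in>Poly_Mapping.keys F. \<Sum>e'\<in>Poly_Mapping.keys G. Poly_Mapping.single (e + e') (Poly_Mapping.lookup F e * Poly_Mapping.lookup G e'))"
    by (simp only: mult_single[symmetric] sum_product[symmetric] poly_mapping_sum_single[symmetric])
  then have "eval v (F * G) = (\<Sum>e\<in>Poly_Mapping.keys F. \<Sum>e'\<in>Poly_Mapping.keys G.
      (\<kappa> (Poly_Mapping.lookup F e) * monom_value v e) * (\<kappa> (Poly_Mapping.lookup G e') * monom_value v e'))"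
    by (simp add: eval_sum eval_single \<kappa>_mult monom_value_add mult_ac)
  also have "\<dots> = eval v F * eval v G"
    by (simp add: eval_def sum_product)
  finally show ?thesis .
qed

lemma eval_1 [simp]: "eval v 1 = 1"
  using eval_single[of v 0 1] by (simp add: \<kappa>_1 monom_value_def)

lemma eval_power: "eval v (F ^ n) = eval v F ^ n"
  by (induction n) (simp_all add: eval_mult)

lemma eval_Const [simp]: "eval v (Const c) = \<kappa> c"
  by (simp add: Const_def eval_single monom_value_def)

lemma eval_Var [simp]: "eval v (Var x) = v x"
  by (cases x) (simp_all add: Var_def eval_single monom_value_def \<kappa>_1 lookup_single when_def)

lemma eval_minus: "eval v (- F) = - eval v F"
  using eval_add[of v F "- F"] by (simp add: eq_neg_iff_add_eq_0 add.commute)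

lemma eval_diff: "eval v (F - G) = eval v F - eval v G"
  using eval_add[of v F "- G"] by (simp add: eval_minus)

lemmas eval_hom = eval_add eval_mult eval_power eval_sum eval_minus eval_diff

lemma eval_monom_value: "eval v (monom_value w e) = monom_value (\<lambda>x. eval v (w x)) e"
  by (simp add: monom_value_def eval_mult eval_power)

end

interpretation form: coeff_hom Const
  by unfold_locales (simp_all add: Const_def single_add mult_single)

interpretation bipoly: coeff_hom "\<lambda>c. [:[:c:]:]"
  by unfold_locales (simp_all add: one_pCons)

lemma (in coeff_hom) eval_form_eval: "eval v (form.eval w F) = eval (\<lambda>x. eval v (w x)) F"
  unfolding form.eval_def eval_sum eval_mult eval_monom_value eval_Const
  by (rule eval_def[symmetric])

lemma form_eval_Var: "form.eval Var F = F"
proof -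
  have pow: "Var x ^ n = Poly_Mapping.single (Poly_Mapping.single x n) 1" for x n
    by (induction n) (simp_all add: Var_def mult_single single_add[symmetric])
  have "monom_value Var e = Poly_Mapping.single e 1" for e
  proof -
    have "e = Poly_Mapping.single X0 (Poly_Mapping.lookup e X0) + Poly_Mapping.single X1 (Poly_Mapping.lookup e X1)
      + Poly_Mapping.single Y0 (Poly_Mapping.lookup e Y0) + Poly_Mapping.single Y1 (Poly_Mapping.lookup e Y1)" (is "e = ?e")
    proof (rule poly_mapping_eqI)
      show "Poly_Mapping.lookup e x = Poly_Mapping.lookup ?e x" for x
        by (cases x) (simp_all add: lookup_add lookup_single when_def)
    qed
    then show ?thesis unfolding monom_value_def pow mult_single by simp
  qed
  then show ?thesis
    unfolding form.eval_def by (subst (3) poly_mapping_sum_single) (simp add: Const_def mult_single)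
qed

lemma bihomogeneous_add:
  "bihomogeneous a b F \<Longrightarrow> bihomogeneous a b G \<Longrightarrow> bihomogeneous a b (F + G)"
  using keys_add[of F G] unfolding bihomogeneous_def by blast

lemma bihomogeneous_0 [simp]: "bihomogeneous a b 0"
  by (simp add: bihomogeneous_def)

lemma bihomogeneous_sum:
  "(\<And>i. i \<in> I \<Longrightarrow> bihomogeneous a b (F i)) \<Longrightarrow> bihomogeneous a b (\<Sum>i\<in>I. F i)"
  by (induction I rule: infinite_finite_induct) (auto intro: bihomogeneous_add)

lemma bihomogeneous_mult:
  assumes "bihomogeneous a b F" "bihomogeneous a' b' G"
  shows "bihomogeneous (a + a') (b + b') (F * G)"
  unfolding bihomogeneous_def
proof
  fix e assume "e \<in> Poly_Mapping.keys (F * G)"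
  then obtain f g where "f \<in> Poly_Mapping.keys F" "g \<in> Poly_Mapping.keys G" "e = f + g"
    using keys_mult[of F G] by auto
  then show "Poly_Mapping.lookup e X0 + Poly_Mapping.lookup e X1 = a + a' \<and> Poly_Mapping.lookup e Y0 + Poly_Mapping.lookup e Y1 = b + b'"
    using assms by (fastforce simp: bihomogeneous_def lookup_add)
qed

lemma bihomogeneous_Const [simp]: "bihomogeneous 0 0 (Const c)"
  by (simp add: bihomogeneous_def Const_def)

lemma bihomogeneous_1 [simp]: "bihomogeneous 0 0 1"
  using bihomogeneous_Const[of 1] by (simp add: Const_def)

lemma bihomogeneous_Var [simp]:
  "bihomogeneous (Suc 0) 0 (Var X0)" "bihomogeneous (Suc 0) 0 (Var X1)"
  "bihomogeneous 0 (Suc 0) (Var Y0)" "bihomogeneous 0 (Suc 0) (Var Y1)"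
  by (simp_all add: bihomogeneous_def Var_def lookup_single when_def)

lemma bihomogeneous_power: "bihomogeneous a b F \<Longrightarrow> bihomogeneous (n * a) (n * b) (F ^ n)"
  by (induction n) (auto dest: bihomogeneous_mult)

lemma bihomogeneous_Const_mult: "bihomogeneous a b F \<Longrightarrow> bihomogeneous a b (Const c * F)"
  using bihomogeneous_mult[OF bihomogeneous_Const] by fastforce

lemma bihomogeneous_minus: "bihomogeneous a b F \<Longrightarrow> bihomogeneous a b (- F)"
  by (simp add: bihomogeneous_def)

lemma bihomogeneous_diff:
  "bihomogeneous a b F \<Longrightarrow> bihomogeneous a b G \<Longrightarrow> bihomogeneous a b (F - G)"
  using bihomogeneous_add[of a b F "- G"] by (simp add: bihomogeneous_minus)

text \<open>The affine chart of \<open>\<P>\<^sup>1\<close> sending \<open>x\<close> to \<open>[x : 1 + u x]\<close>; it misses only \<open>[1 : u]\<close>.\<close>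

definition dehom_vars :: "complex \<Rightarrow> var \<Rightarrow> bipoly" where
  "dehom_vars u x = (case x of X0 \<Rightarrow> [:[:0, 1:]:] | X1 \<Rightarrow> [:[:1, u:]:]
     | Y0 \<Rightarrow> [:0, 1:] | Y1 \<Rightarrow> [:1, [:u:]:])"

definition dehom :: "complex \<Rightarrow> form_ring \<Rightarrow> bipoly" where
  "dehom u = bipoly.eval (dehom_vars u)"

text \<open>Reduces injectivity of \<open>dehom u\<close> on bi-homogeneous forms to \<open>u = 0\<close>, where monomials go to monomials.\<close>

definition shear_vars :: "complex \<Rightarrow> var \<Rightarrow> form_ring" where
  "shear_vars u x = (case x of X0 \<Rightarrow> Var X0 | X1 \<Rightarrow> Var X1 + Const u * Var X0
     | Y0 \<Rightarrow> Var Y0 | Y1 \<Rightarrow> Var Y1 + Const u * Var Y0)"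

lemma bihomogeneous_form_eval:
  assumes F: "bihomogeneous a b F"
    and w: "bihomogeneous (Suc 0) 0 (w X0)" "bihomogeneous (Suc 0) 0 (w X1)"
      "bihomogeneous 0 (Suc 0) (w Y0)" "bihomogeneous 0 (Suc 0) (w Y1)"
  shows "bihomogeneous a b (form.eval w F)"
  unfolding form.eval_def
proof (intro bihomogeneous_sum bihomogeneous_Const_mult)
  fix e assume "e \<in> Poly_Mapping.keys F"
  then have e: "a = Poly_Mapping.lookup e X0 + Poly_Mapping.lookup e X1" "b = Poly_Mapping.lookup e Y0 + Poly_Mapping.lookup e Y1"
    using F by (auto simp: bihomogeneous_def)
  have "bihomogeneous (Poly_Mapping.lookup e X0 * Suc 0 + Poly_Mapping.lookup e X1 * Suc 0 + Poly_Mapping.lookup e Y0 * 0 + Poly_Mapping.lookup e Y1 * 0)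
      (Poly_Mapping.lookup e X0 * 0 + Poly_Mapping.lookup e X1 * 0 + Poly_Mapping.lookup e Y0 * Suc 0 + Poly_Mapping.lookup e Y1 * Suc 0) (monom_value w e)"
    unfolding monom_value_def by (intro bihomogeneous_mult bihomogeneous_power w)
  then show "bihomogeneous a b (monom_value w e)" by (simp add: e)
qed

lemma bideg_dehom:
  assumes F: "bihomogeneous a b F"
  shows "bideg a b (dehom u F)"
  unfolding dehom_def bipoly.eval_def
proof (intro bideg_sum bideg_bconst_mult)
  fix e assume "e \<in> Poly_Mapping.keys F"
  then have e: "a = Poly_Mapping.lookup e X0 + Poly_Mapping.lookup e X1" "b = Poly_Mapping.lookup e Y0 + Poly_Mapping.lookup e Y1"
    using F by (auto simp: bihomogeneous_def)
  have "bideg (Suc 0) 0 (dehom_vars u X0)" "bideg (Suc 0) 0 (dehom_vars u X1)"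
    "bideg 0 (Suc 0) (dehom_vars u Y0)" "bideg 0 (Suc 0) (dehom_vars u Y1)"
    by (auto simp: dehom_vars_def bideg_iff coeff_pCons one_pCons split: nat.splits if_splits)
  then have "bideg (Poly_Mapping.lookup e X0 * Suc 0 + Poly_Mapping.lookup e X1 * Suc 0 + Poly_Mapping.lookup e Y0 * 0 + Poly_Mapping.lookup e Y1 * 0)
      (Poly_Mapping.lookup e X0 * 0 + Poly_Mapping.lookup e X1 * 0 + Poly_Mapping.lookup e Y0 * Suc 0 + Poly_Mapping.lookup e Y1 * Suc 0)
      (monom_value (dehom_vars u) e)"
    unfolding monom_value_def by (intro bideg_mult bideg_power)
  then show "bideg a b (monom_value (dehom_vars u) e)" by (simp add: e)
qed

text \<open>Within a fixed bi-degree the exponents of \<open>X0\<close> and \<open>Y0\<close>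
  determine the monomial, so distinct monomials have distinct images.\<close>

lemma dehom_0_inj:
  assumes F: "bihomogeneous a b F" and "dehom 0 F = 0"
  shows "F = 0"
proof (rule ccontr)
  assume "F \<noteq> 0"
  then obtain e where e: "e \<in> Poly_Mapping.keys F" by (metis all_not_in_conv keys_eq_empty)
  have "monom_value (dehom_vars 0) e' = monom (monom 1 (Poly_Mapping.lookup e' X0)) (Poly_Mapping.lookup e' Y0)" for e'
    by (simp add: monom_value_def dehom_vars_def monom_altdef poly_const_pow one_pCons[symmetric])
  then have "coeff (coeff (dehom 0 F) (Poly_Mapping.lookup e Y0)) (Poly_Mapping.lookup e X0)
      = (\<Sum>e'\<in>Poly_Mapping.keys F. Poly_Mapping.lookup F e' * coeff (coeff (monom (monom 1 (Poly_Mapping.lookup e' X0)) (Poly_Mapping.lookup e' Y0)) (Poly_Mapping.lookup e Y0)) (Poly_Mapping.lookup e X0))"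
    by (simp add: dehom_def bipoly.eval_def coeff_sum)
  also have "\<dots> = (\<Sum>e'\<in>Poly_Mapping.keys F. if e' = e then Poly_Mapping.lookup F e' else 0)"
  proof (intro sum.cong refl)
    fix e' assume e': "e' \<in> Poly_Mapping.keys F"
    have "e' = e" if "Poly_Mapping.lookup e' X0 = Poly_Mapping.lookup e X0" "Poly_Mapping.lookup e' Y0 = Poly_Mapping.lookup e Y0"
    proof (rule poly_mapping_eqI)
      have "Poly_Mapping.lookup e' X1 = Poly_Mapping.lookup e X1" "Poly_Mapping.lookup e' Y1 = Poly_Mapping.lookup e Y1"
        using F e e' that by (auto simp: bihomogeneous_def) (metis add_left_cancel)+
      then show "Poly_Mapping.lookup e' x = Poly_Mapping.lookup e x" for x
        using that by (cases x) simp_all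
    qed
    then show "Poly_Mapping.lookup F e' * coeff (coeff (monom (monom 1 (Poly_Mapping.lookup e' X0)) (Poly_Mapping.lookup e' Y0)) (Poly_Mapping.lookup e Y0)) (Poly_Mapping.lookup e X0)
        = (if e' = e then Poly_Mapping.lookup F e' else 0)"
      by auto
  qed
  also have "\<dots> = Poly_Mapping.lookup F e" using e by simp
  finally show False using assms(2) e by (simp add: in_keys_iff)
qed

lemma dehom_inj:
  assumes F: "bihomogeneous a b F" and "dehom u F = 0"
  shows "F = 0"
proof -
  \<comment> \<open>The chart with parameter \<open>u\<close> is the standard chart after the
    shear.\<close>
  have "dehom_vars u = (\<lambda>x. bipoly.eval (dehom_vars 0) (shear_vars u x))"
    by (rule ext) (auto simp: dehom_vars_def shear_vars_def bipoly.eval_hom one_pCons split: var.split)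
  then have "dehom 0 (form.eval (shear_vars u) F) = dehom u F"
    by (simp add: dehom_def bipoly.eval_form_eval)
  moreover have "bihomogeneous a b (form.eval (shear_vars u) F)"
    by (rule bihomogeneous_form_eval[OF F])
      (auto simp: shear_vars_def intro!: bihomogeneous_add bihomogeneous_Const_mult)
  ultimately have "form.eval (shear_vars u) F = 0"
    using assms(2) dehom_0_inj by metis
  \<comment> \<open>The shear with parameter \<open>- u\<close> is the inverse.\<close>
  moreover have "form.eval (shear_vars (- u)) (form.eval (shear_vars u) F) = form.eval Var F"
  proof -
    have "Const (- u) = - Const u" by (simp add: Const_def single_uminus)
    then have "(\<lambda>x. form.eval (shear_vars (- u)) (shear_vars u x)) = Var"
      by (intro ext) (auto simp: shear_vars_def form.eval_hom split: var.split)
    then show ?thesis by (simp add: form.eval_form_eval)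
  qed
  ultimately show ?thesis by (simp add: form_eval_Var)
qed

section \<open>Symbolic powers in the affine chart\<close>

lemma ideal_gen_superset: "S \<subseteq> ideal_gen S"
proof -
  interpret module "(*) :: 'a \<Rightarrow> 'a \<Rightarrow> 'a" by (rule module_times)
  show ?thesis unfolding ideal_gen_def by (rule span_superset)
qed

lemma ideal_gen_minimal:
  assumes "S \<subseteq> T" "0 \<in> T" "\<And>x y. x \<in> T \<Longrightarrow> y \<in> T \<Longrightarrow> x + y \<in> T" "\<And>c x. x \<in> T \<Longrightarrow> c * x \<in> T"
  shows "ideal_gen S \<subseteq> T"
proof -
  interpret module "(*) :: 'a \<Rightarrow> 'a \<Rightarrow> 'a" by (rule module_times)
  show ?thesis
    unfolding ideal_gen_def using assms by (intro span_minimal) (auto simp: subspace_def)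
qed

lemma ideal_gen_closed:
  "0 \<in> ideal_gen S" "x \<in> ideal_gen S \<Longrightarrow> y \<in> ideal_gen S \<Longrightarrow> x + y \<in> ideal_gen S"
  "x \<in> ideal_gen S \<Longrightarrow> c * x \<in> ideal_gen S"
proof -
  interpret module "(*) :: 'a \<Rightarrow> 'a \<Rightarrow> 'a" by (rule module_times)
  show "0 \<in> ideal_gen S" "x \<in> ideal_gen S \<Longrightarrow> y \<in> ideal_gen S \<Longrightarrow> x + y \<in> ideal_gen S"
    "x \<in> ideal_gen S \<Longrightarrow> c * x \<in> ideal_gen S"
    unfolding ideal_gen_def by (auto intro: span_zero span_add span_scale)
qed

lemma ideal_power_closed:
  "0 \<in> ideal_power I m" "x \<in> ideal_power I m \<Longrightarrow> y \<in> ideal_power I m \<Longrightarrow> x + y \<in> ideal_power I m"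
  "x \<in> ideal_power I m \<Longrightarrow> c * x \<in> ideal_power I m"
  by (cases m; simp add: ideal_mult_def ideal_gen_closed)+

lemma ideal_power_sum:
  "(\<And>i. i \<in> A \<Longrightarrow> F i \<in> ideal_power I m) \<Longrightarrow> (\<Sum>i\<in>A. F i) \<in> ideal_power I m"
  by (induction A rule: infinite_finite_induct) (auto intro: ideal_power_closed)

lemma ideal_power_SucI: "f \<in> I \<Longrightarrow> g \<in> ideal_power I m \<Longrightarrow> f * g \<in> ideal_power I (Suc m)"
  unfolding ideal_power.simps ideal_mult_def by (rule subsetD[OF ideal_gen_superset]) blast

text \<open>One factor \<open>f\<close>, or \<open>g\<close> once \<open>f\<close> is exhausted, is
  peeled off for each step of the power; the surplus is absorbed.\<close>

lemma power_mult_in_ideal_power: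
  "f \<in> I \<Longrightarrow> g \<in> I \<Longrightarrow> m \<le> i + j \<Longrightarrow> f ^ i * g ^ j * h \<in> ideal_power I m"
proof (induction m arbitrary: i j)
  case (Suc m)
  show ?case
  proof (cases i)
    case (Suc i')
    then have "f * (f ^ i' * g ^ j * h) \<in> ideal_power I (Suc m)"
      using Suc.prems by (intro ideal_power_SucI Suc.IH) auto
    then show ?thesis by (simp only: Suc power_Suc mult.assoc)
  next
    case 0
    then obtain j' where j': "j = Suc j'" using Suc.prems by (cases j) auto
    then have "g * (f ^ i * g ^ j' * h) \<in> ideal_power I (Suc m)"
      using Suc.prems by (intro ideal_power_SucI Suc.IH) auto
    then show ?thesis by (simp only: j' power_Suc mult_ac)
  qed
qed simp

text \<open>The ideal of the point with affine coordinates \<open>P\<close>, given by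
  representatives so that its generators are explicit.\<close>

definition chart_ideal :: "complex \<Rightarrow> complex \<times> complex \<Rightarrow> form_ring set" where
  "chart_ideal u P = rep_ideal (fst P, 1 + u * fst P) (snd P, 1 + u * snd P)"

lemma dehom_hom:
  "dehom u (F + G) = dehom u F + dehom u G" "dehom u (F * G) = dehom u F * dehom u G"
  "dehom u (F - G) = dehom u F - dehom u G" "dehom u (F ^ n) = dehom u F ^ n"
  "dehom u (\<Sum>i\<in>I. f i) = (\<Sum>i\<in>I. dehom u (f i))" "dehom u 0 = 0"
  "dehom u (Const c) = [:[:c:]:]" "dehom u (Var x) = dehom_vars u x"
  by (simp_all add: dehom_def bipoly.eval_hom)

text \<open>With the representative \<open>(a, 1 + u * a)\<close> the terms in \<open>u\<close>
  cancel, so no scalar factor remains.\<close>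

lemma dehom_chart_generators:
  "dehom u (Const (1 + u * a) * Var X0 - Const a * Var X1) = [:[:- a, 1:]:]"
  "dehom u (Const (1 + u * c) * Var Y0 - Const c * Var Y1) = [:[:- c:], 1:]"
  by (simp_all add: dehom_hom dehom_vars_def algebra_simps one_pCons)

lemma vanish_dehom:
  assumes "F \<in> ideal_power (chart_ideal u P) m"
  shows "vanish m P (dehom u F)"
  using assms
proof (induction m arbitrary: F)
  case (Suc m)
  have 1: "vanish 1 P (dehom u F)" if "F \<in> chart_ideal u P" for F
  proof -
    have "chart_ideal u P \<subseteq> {F. vanish 1 P (dehom u F)}"
      unfolding chart_ideal_def rep_ideal_def prod.case
      using vanish_lin_x[of "fst P" "snd P"] vanish_lin_y[of "fst P" "snd P"]
      by (intro ideal_gen_minimal) (auto simp only: insert_subset empty_subsetI mem_Collect_eq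
          dehom_chart_generators prod.collapse dehom_hom(1,2,6) vanish_0 intro: vanish_add vanish_mult_right)
    then show ?thesis using that by blast
  qed
  have "ideal_power (chart_ideal u P) (Suc m) \<subseteq> {F. vanish (Suc m) P (dehom u F)}"
    unfolding ideal_power.simps ideal_mult_def
  proof (intro ideal_gen_minimal)
    show "{f * g | f g. f \<in> chart_ideal u P \<and> g \<in> ideal_power (chart_ideal u P) m}
        \<subseteq> {F. vanish (Suc m) P (dehom u F)}"
      using vanish_mult[OF 1 Suc.IH] by (auto simp: dehom_hom)
  qed (auto simp: dehom_hom intro: vanish_add vanish_mult_right)
  then show ?case using Suc.prems by blast
qed simp

text \<open>Each Taylor term at \<open>P\<close> is lifted to generators of the point ideal and
  padded to the right bi-degree; terms below order \<open>m\<close> have coefficient 0, and the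
  others lie in the power of the ideal.\<close>

lemma homogenization_exists:
  assumes g: "bideg k l g"
  shows "\<exists>G. bihomogeneous k l G \<and> dehom u G = g \<and>
    (\<forall>m. vanish m P g \<longrightarrow> G \<in> ideal_power (chart_ideal u P) m)"
proof -
  obtain a c where P: "P = (a, c)" by (cases P)
  define e where "e i j = coeff (coeff (translate (a, c) g) j) i" for i j
  \<comment> \<open>\<open>?f'\<close> and \<open>?g'\<close> define the lines missing from the
    chart and dehomogenize to 1, which makes them suitable padding.\<close>
  let ?f = "Const (1 + u * a) * Var X0 - Const a * Var X1" and ?f' = "Var X1 - Const u * Var X0"
  let ?g = "Const (1 + u * c) * Var Y0 - Const c * Var Y1" and ?g' = "Var Y1 - Const u * Var Y0"
  define G where "G = (\<Sum>j\<le>l. \<Sum>i\<le>k. Const (e i j) * (?f ^ i * ?g ^ j * (?f' ^ (k - i) * ?g' ^ (l - j))))"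
  have "bihomogeneous k l G"
    unfolding G_def
  proof (intro bihomogeneous_sum bihomogeneous_Const_mult)
    fix i j assume "j \<in> {..l}" "i \<in> {..k}"
    have "bihomogeneous (Suc 0) 0 ?f" "bihomogeneous (Suc 0) 0 ?f'"
      "bihomogeneous 0 (Suc 0) ?g" "bihomogeneous 0 (Suc 0) ?g'"
      by (intro bihomogeneous_diff bihomogeneous_Const_mult bihomogeneous_Var)+
    then have "bihomogeneous (i * Suc 0 + j * 0 + ((k - i) * Suc 0 + (l - j) * 0))
        (i * 0 + j * Suc 0 + ((k - i) * 0 + (l - j) * Suc 0))
        (?f ^ i * ?g ^ j * (?f' ^ (k - i) * ?g' ^ (l - j)))"
      by (intro bihomogeneous_mult bihomogeneous_power)
    then show "bihomogeneous k l (?f ^ i * ?g ^ j * (?f' ^ (k - i) * ?g' ^ (l - j)))"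
      using \<open>j \<in> {..l}\<close> \<open>i \<in> {..k}\<close> by simp
  qed
  moreover have "dehom u G = g"
  proof -
    have "dehom u ?f' = 1" "dehom u ?g' = 1"
      by (simp_all add: dehom_hom dehom_vars_def one_pCons)
    then have "dehom u G = (\<Sum>j\<le>l. \<Sum>i\<le>k. [:[:e i j:]:] * ([:[:- a, 1:]:] ^ i * [:[:- c:], 1:] ^ j))"
      unfolding G_def
      by (simp only: dehom_hom(2,4,5,7) dehom_chart_generators power_one mult_1_right)
    also have "\<dots> = g"
      unfolding e_def by (subst (2) taylor_expand[OF g, of a c]) (simp only: mult.assoc)
    finally show ?thesis .
  qed
  moreover have "G \<in> ideal_power (chart_ideal u P) m" if van: "vanish m P g" for m
    unfolding G_def
  proof (intro ideal_power_sum)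
    fix i j
    show "Const (e i j) * (?f ^ i * ?g ^ j * (?f' ^ (k - i) * ?g' ^ (l - j))) \<in> ideal_power (chart_ideal u P) m"
    proof (cases "i + j < m")
      case True
      then have "e i j = 0" using van by (simp add: e_def vanish_def P)
      then show ?thesis by (simp add: Const_def ideal_power_closed)
    next
      case False
      have "{?f, ?g} \<subseteq> chart_ideal u P"
        unfolding chart_ideal_def rep_ideal_def P prod.case fst_conv snd_conv
        by (rule ideal_gen_superset)
      then show ?thesis
        using False by (intro ideal_power_closed(3) power_mult_in_ideal_power) auto
    qed
  qed
  ultimately show ?thesis by blast
qed

text \<open>\<open>homogenization_exists\<close> builds the form from the Taylor expansion at \<open>P\<close>; since \<open>dehom\<close> is
  injective, it is the same form for all \<open>P\<close>.\<close>

lemma homogenization: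
  assumes g: "bideg k l g"
  obtains G where "bihomogeneous k l G" "dehom u G = g"
    "\<And>P m. vanish m P g \<Longrightarrow> G \<in> ideal_power (chart_ideal u P) m"
proof -
  obtain G where G: "bihomogeneous k l G" "dehom u G = g"
    using homogenization_exists[OF g, of u] by blast
  have "G \<in> ideal_power (chart_ideal u P) m" if "vanish m P g" for P m
  proof -
    obtain G' where G': "bihomogeneous k l G'" "dehom u G' = g" "G' \<in> ideal_power (chart_ideal u P) m"
      using homogenization_exists[OF g, of u P] \<open>vanish m P g\<close> by blast
    have "G - G' = 0"
      by (rule dehom_inj[where u = u], rule bihomogeneous_diff[OF G(1) G'(1)])
        (simp add: dehom_hom G(2) G'(2))
    then show ?thesis using G'(3) by simp
  qed
  with G show thesis using that by blast
qed

lemma affine_grid_if_alpha_star_eq: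
  assumes "finite A"
    and eq: "alpha_star (\<Inter>P\<in>A. ideal_power (chart_ideal u P) m)
      = alpha_star (\<Inter>P\<in>A. ideal_power (chart_ideal u P) (m + 1))"
  shows "\<exists>V H. A = V \<times> H"
proof (cases "A = {}")
  case False
  define J where "J m = (\<Inter>P\<in>A. ideal_power (chart_ideal u P) m)" for m
  define k where "k = alpha_star (J (m + 1))"
  have form: "\<exists>G\<in>J n. G \<noteq> 0 \<and> bihomogeneous i i G"
    if "bideg i i g" "g \<noteq> 0" "\<And>P. P \<in> A \<Longrightarrow> vanish n P g" for g i n
  proof -
    obtain G where G: "bihomogeneous i i G" "dehom u G = g"
      "\<And>P m. vanish m P g \<Longrightarrow> G \<in> ideal_power (chart_ideal u P) m"
      using homogenization[OF \<open>bideg i i g\<close>, of u] by blast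
    have "G \<noteq> 0" using G(2) \<open>g \<noteq> 0\<close> by (auto simp: dehom_hom)
    moreover have "G \<in> J n" unfolding J_def using G(3) that(3) by blast
    ultimately show ?thesis using G(1) by blast
  qed
  have "\<exists>F\<in>J (m + 1). F \<noteq> 0 \<and> bihomogeneous k k F"
  proof -
    \<comment> \<open>Vertical lines through all points, with multiplicity \<open>m + 1\<close>,
      witness that the minimum defining \<open>k\<close> is attained.\<close>
    let ?g = "\<Prod>P\<in>A. [:[:- fst P, 1:]:] ^ (m + 1) :: bipoly" and ?K = "\<Sum>P\<in>A. (m + 1) * Suc 0"
    have "bideg ?K (\<Sum>P\<in>A. (m + 1) * 0) ?g"
      by (intro bideg_prod bideg_power bideg_lin_x)
    then have "bideg ?K ?K ?g" by (rule bideg_mono) auto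
    moreover have "?g \<noteq> 0" using \<open>finite A\<close> by simp
    moreover have "vanish (m + 1) P ?g" if "P \<in> A" for P
      using vanish_power[OF vanish_lin_x[of "fst P" "snd P"], of "m + 1"] that \<open>finite A\<close>
      by (intro vanish_prod) simp_all
    ultimately have "\<exists>F\<in>J (m + 1). F \<noteq> 0 \<and> bihomogeneous ?K ?K F" by (rule form)
    then show ?thesis unfolding k_def alpha_star_def by (rule LeastI)
  qed
  then obtain F where F: "F \<in> J (m + 1)" "F \<noteq> 0" "bihomogeneous k k F" by blast
  have "dehom u F \<noteq> 0" using dehom_inj[OF F(3)] F(2) by blast
  moreover have "bideg k k (dehom u F)" using F(3) by (rule bideg_dehom)
  moreover have "vanish (m + 1) P (dehom u F)" if "P \<in> A" for P
    using F(1) that unfolding J_def by (intro vanish_dehom) blast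
  \<comment> \<open>A non-zero \<open>g\<close> would lift to a form of bi-degree
    \<open>(k - 1, k - 1)\<close> in \<open>J m\<close>, whose \<open>alpha_star\<close> is also
    \<open>k\<close>.\<close>
  moreover have "g = 0" if "k > 0" "bideg (k - 1) (k - 1) g" "\<And>P. P \<in> A \<Longrightarrow> vanish m P g" for g
  proof (rule ccontr)
    assume "g \<noteq> 0"
    from form[OF that(2) this that(3)] have "alpha_star (J m) \<le> k - 1"
      unfolding alpha_star_def by (rule Least_le)
    moreover have "alpha_star (J m) = k" unfolding k_def J_def by (rule eq)
    ultimately show False using \<open>k > 0\<close> by simp
  qed
  ultimately show ?thesis by (rule affine_grid[OF \<open>finite A\<close> False])
qed auto

section \<open>From projective points to a common affine chart\<close>

lemma point_ideal_abs_p1: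
  assumes "p \<noteq> (0, 0)" "q \<noteq> (0, 0)"
  shows "point_ideal (abs_p1 p) (abs_p1 q) = rep_ideal p q"
proof -
  have "proportional r r" if "r \<noteq> (0, 0)" for r
    unfolding proportional_def using that by (intro conjI exI[of _ 1]) simp_all
  then show ?thesis using assms by (simp add: point_ideal.abs_eq)
qed

text \<open>Dividing a representative \<open>(a, b)\<close> by \<open>b - u * a\<close> gives it the
  shape \<open>(x, 1 + u * x)\<close>.\<close>

lemma p1_chart:
  obtains a b where "(a, b) \<noteq> (0, 0)"
    "\<And>u. b \<noteq> u * a \<Longrightarrow> p = abs_p1 (a / (b - u * a), 1 + u * (a / (b - u * a)))"
proof -
  obtain a b where ab: "rep_p1 p = (a, b)" by (cases "rep_p1 p")
  have p: "abs_p1 (a, b) = p" "proportional (a, b) (a, b)"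
    using Quotient3_abs_rep[OF Quotient3_p1, of p] Quotient3_rep_reflp[OF Quotient3_p1, of p] ab by simp_all
  have "p = abs_p1 (a / (b - u * a), 1 + u * (a / (b - u * a)))" if "b \<noteq> u * a" for u
  proof -
    have "1 + u * (a / (b - u * a)) = b / (b - u * a)"
      using that by (simp add: field_simps)
    moreover have "proportional (a, b) (a / (b - u * a), b / (b - u * a))"
      using that p(2) unfolding proportional_def by (auto intro!: exI[of _ "1 / (b - u * a)"])
    ultimately show ?thesis
      using Quotient3_rel_abs[OF Quotient3_p1] p(1) by metis
  qed
  moreover have "(a, b) \<noteq> (0, 0)" using p(2) by (simp add: proportional_def)
  ultimately show thesis using that by blast
qed

text \<open>Each point excludes at most one value of \<open>u\<close>, and the field is
  infinite.\<close>

lemma common_chart: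
  assumes "finite S"
  obtains u where "\<And>p. p \<in> S \<Longrightarrow> \<exists>a. p = abs_p1 (a, 1 + u * a)"
proof -
  have "\<exists>B. finite B \<and> (\<forall>u. u \<notin> B \<longrightarrow> (\<exists>a. p = abs_p1 (a, 1 + u * a)))" for p
  proof -
    obtain a b where ab: "(a, b) \<noteq> (0, 0)"
      "\<And>u. b \<noteq> u * a \<Longrightarrow> p = abs_p1 (a / (b - u * a), 1 + u * (a / (b - u * a)))"
      using p1_chart by blast
    have "{u. b = u * a} \<subseteq> {b / a}" using ab(1) by auto
    then have "finite {u. b = u * a}" using finite_subset by blast
    then show ?thesis using ab(2) by (intro exI[of _ "{u. b = u * a}"]) blast
  qed
  then obtain B where B: "\<And>p. finite (B p)" "\<And>p u. u \<notin> B p \<Longrightarrow> \<exists>a. p = abs_p1 (a, 1 + u * a)"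
    by metis
  have "finite (\<Union>p\<in>S. B p)" using assms B(1) by blast
  then obtain u where "u \<notin> (\<Union>p\<in>S. B p)"
    using ex_new_if_finite infinite_UNIV_char_0 by blast
  then show thesis using that B(2) by blast
qed

theorem theorem2p2:
  fixes Z :: "(p1 \<times> p1) set" and m :: nat
  assumes "finite Z"
    and "m \<ge> 1"
    and "alpha_star (symbolic_power Z m) = alpha_star (symbolic_power Z (m + 1))"
  shows "\<exists>Z\<^sub>V Z\<^sub>H :: p1 set. finite Z\<^sub>V \<and> finite Z\<^sub>H \<and> Z = Z\<^sub>V \<times> Z\<^sub>H"
proof -
  \<comment> \<open>Both projections are collected so that the same \<open>u\<close> serves the two
    factors.\<close>
  have fin: "finite (fst ` Z \<union> snd ` Z)" using \<open>finite Z\<close> by blast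
  obtain u where u: "\<And>p. p \<in> fst ` Z \<union> snd ` Z \<Longrightarrow> \<exists>a. p = abs_p1 (a, 1 + u * a)"
    using common_chart[OF fin] by blast
  define pt where "pt a = abs_p1 (a, 1 + u * a)" for a
  obtain coord where coord: "\<And>p. p \<in> fst ` Z \<union> snd ` Z \<Longrightarrow> pt (coord p) = p"
    using u unfolding pt_def by metis
  define A where "A = (\<lambda>(p, q). (coord p, coord q)) ` Z"
  have Z: "Z = (\<lambda>(a, c). (pt a, pt c)) ` A"
    unfolding A_def image_image using coord by (force simp: case_prod_beta)
  have "point_ideal (pt a) (pt c) = chart_ideal u (a, c)" for a c
    unfolding pt_def chart_ideal_def by (subst point_ideal_abs_p1) auto
  then have "symbolic_power Z n = (\<Inter>P\<in>A. ideal_power (chart_ideal u P) n)" for n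
    unfolding symbolic_power_def Z by (auto simp: case_prod_beta)
  with assms(3) obtain V H where "A = V \<times> H"
    using affine_grid_if_alpha_star_eq[of A u m] \<open>finite Z\<close> unfolding A_def by auto
  then have "Z = pt ` V \<times> pt ` H" unfolding Z by auto
  \<comment> \<open>The factors are replaced by the projections of \<open>Z\<close>, which are
    visibly finite; if one factor is empty, both projections are.\<close>
  then have "Z = fst ` Z \<times> snd ` Z" by auto
  moreover have "finite (fst ` Z)" "finite (snd ` Z)" using \<open>finite Z\<close> by auto
  ultimately show ?thesis by blast
qed

end
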